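(* There exists a constant $c>0$ such that for every $\varepsilon>0$, $$\lim_{L\to\infty}\mathbf P_{\mathrm{unif},L}\Big(\exists\, i\in\{1,2,3,4\}\ \text{such that}\ \sup_{t\in[0,1]}\big|\tilde\pi^L_t-c\,t\,\vec e_i\big|\le \varepsilon\Big)=1 .$$
   Context: $\mathbb N=\{1,2,3,\dots\}$. For $L\in\mathbb N$, $\Omega_L$ is the set of $L$-step prudent paths on $\mathbb Z^2$: sequences $\pi=(\pi_i)_{i=0}^L$ in $\mathbb Z^2$ with $\pi_0=(0,0)$, $\pi_{i+1}-\pi_i\in\{(\pm1,0),(0,\pm1)\}$, and $\big(\pi_i+\mathbb N(\pi_{i+1}-\pi_i)\big)\cap\{\pi_0,\dots,\pi_i\}=\emptyset$ for all $0\le i\le L-1$ (no step is taken in the direction of an already visited site). $\mathbf P_{\mathrm{unif},L}$ is the uniform probability measure on $\Omega_L$. For $\pi\in\Omega_L$, $\tilde\pi^L:[0,1]\to\mathbb R^2$ is the rescaled, linearly interpolated path $\tilde\pi^L_t=\frac1L\big(\pi_{\lfloor tL\rfloor}+(tL-\lfloor tL\rfloor)(\pi_{\lfloor tL\rfloor+1}-\pi_{\lfloor tL\rfloor})\big)$ (with $\tilde\pi^L_1=\pi_L/L$). The diagonal directions are $\vec e_1=(1,1)$, $\vec e_2=(-1,1)$, $\vec e_3=(-1,-1)$, $\vec e_4=(1,-1)$. *)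

theory Defs
  imports "HOL-Probability.Probability"
begin

definition unit_steps :: "(int \<times> int) set" where
  "unit_steps = {(1, 0), (-1, 0), (0, 1), (0, -1)}"

text \<open>The open lattice ray \<open>p + \<nat> d\<close>; here \<open>\<nat> = {1, 2, 3, \<dots>}\<close>, so \<open>p\<close> itself is excluded.\<close>

definition lattice_ray :: "int \<times> int \<Rightarrow> int \<times> int \<Rightarrow> (int \<times> int) set" where
  "lattice_ray p d = {(fst p + int n * fst d, snd p + int n * snd d) | n. n \<ge> 1}"

text \<open>A path \<open>(\<pi>\<^sub>0, \<dots>, \<pi>\<^sub>L)\<close> is a list of length \<open>L + 1\<close>.\<close>

definition prudent_paths :: "nat \<Rightarrow> (int \<times> int) list set" where
  "prudent_paths L = {\<pi>. length \<pi> = Suc L \<and> \<pi> ! 0 = (0, 0) \<and>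
     (\<forall>i<L. \<pi> ! Suc i - \<pi> ! i \<in> unit_steps \<and>
        lattice_ray (\<pi> ! i) (\<pi> ! Suc i - \<pi> ! i) \<inter> (!) \<pi> ` {0..i} = {})}"

lemma finite_prudent_paths: "finite (prudent_paths L)"
proof -
  let ?B = "{- int L..int L} \<times> {- int L..int L}"
  have bound: "\<bar>fst (\<pi> ! i)\<bar> \<le> int i \<and> \<bar>snd (\<pi> ! i)\<bar> \<le> int i"
    if "\<pi> \<in> prudent_paths L" "i \<le> L" for \<pi> i
    using that(2)
  proof (induction i)
    case 0
    then show ?case using that(1) by (simp add: prudent_paths_def)
  next
    case (Suc i)
    have "\<pi> ! Suc i - \<pi> ! i \<in> unit_steps"
      using that(1) Suc.prems by (simp add: prudent_paths_def)
    then have "\<bar>fst (\<pi> ! Suc i) - fst (\<pi> ! i)\<bar> \<le> 1 \<and> \<bar>snd (\<pi> ! Suc i) - snd (\<pi> ! i)\<bar> \<le> 1"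
      by (auto simp: unit_steps_def prod_eq_iff)
    then show ?case using Suc by auto
  qed
  have "\<pi> ! i \<in> ?B" if "\<pi> \<in> prudent_paths L" "i < Suc L" for \<pi> i
    using bound[OF that(1), of i] that(2) by (cases "\<pi> ! i") auto
  then have "prudent_paths L \<subseteq> {\<pi>. set \<pi> \<subseteq> ?B \<and> length \<pi> = Suc L}"
    by (fastforce simp: in_set_conv_nth prudent_paths_def)
  then show ?thesis
    by (rule finite_subset) (rule finite_lists_length_eq, simp)
qed

lemma prudent_paths_nonempty: "prudent_paths L \<noteq> {}"
proof -
  have "map (\<lambda>k. (int k, 0)) [0..<Suc L] \<in> prudent_paths L"
    by (auto simp: prudent_paths_def unit_steps_def lattice_ray_def nth_append simp del: upt_Suc)
  then show ?thesis by blast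
qed

text \<open>Well defined because \<open>prudent_paths L\<close> is finite and nonempty.\<close>

definition P_unif :: "nat \<Rightarrow> (int \<times> int) list pmf" where
  "P_unif L = pmf_of_set (prudent_paths L)"

definition to_plane :: "int \<times> int \<Rightarrow> real \<times> real" where
  "to_plane p = (real_of_int (fst p), real_of_int (snd p))"

text \<open>
  For \<open>t = 1\<close> the entry with index \<open>L + 1\<close> does not exist, but the term containing it has
  coefficient \<open>0\<close>, so the value at \<open>1\<close> is \<open>\<pi>\<^sub>L / L\<close>.
\<close>

definition rescaled_path :: "nat \<Rightarrow> (int \<times> int) list \<Rightarrow> real \<Rightarrow> real \<times> real" where
  "rescaled_path L \<pi> t =
     (let k = nat \<lfloor>t * real L\<rfloor> in
      (1 / real L) *\<^sub>R (to_plane (\<pi> ! k) +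
        (t * real L - real k) *\<^sub>R (to_plane (\<pi> ! Suc k) - to_plane (\<pi> ! k))))"

lemma rescaled_path_1: "rescaled_path L \<pi> 1 = (1 / real L) *\<^sub>R to_plane (\<pi> ! L)"
  by (simp add: rescaled_path_def)

definition diag_dir :: "nat \<Rightarrow> real \<times> real" where
  "diag_dir i = (if i = 1 then (1, 1) else if i = 2 then (-1, 1)
                 else if i = 3 then (-1, -1) else (1, -1))"

end

theory Submission
  imports Defs "HOL-Real_Asymp.Real_Asymp"
begin

text \<open>
  A prudent walk always ends on the boundary of its bounding box, and its possible continuations
  depend only on the size of the box, the distances to its sides and the last step. This gives a
  transfer recursion, for which explicit super- and subsolutions built from powers \<open>\<rho> ^ i\<close> of the
  distance \<open>i\<close> to a corner exist. They show that the number of walks grows like \<open>\<sigma> ^ (-L)\<close> up to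
  subexponential factors and, by exponential tilting, that all but an exponentially small
  fraction of the walks have a box of width and height close to \<open>c L\<close> and end close to a
  corner of it. Since a suffix of a prudent walk is prudent, the same holds simultaneously for all
  prefixes of macroscopic length. A walk which is near a corner of a large box at all times cannot
  change corner, so it follows one of the four diagonals.
\<close>

section \<open>The geometry of prudent walks\<close>

text \<open>The recursion couples the two corners ahead of the walk and the two axes of a finite
  box, so it is not solved exactly. Inequalities suffice because every estimate may lose a factor
  \<open>exp (\<eta> * L)\<close> with \<eta> as small as desired: an atypical prefix of length at
  least \<open>a * L\<close> gains \<open>exp (- (\<delta> * a * L))\<close> with \<delta> fixed.
  This freedom is spent at criticality, where the weights \<open>F\<close> of the two kinds of
  phases multiply to 1: a product slightly below 1 leaves room for a supersolution, an untilted
  \<open>F\<close> slightly above 1 for a subsolution. The constant \<open>speed\<close> is the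
  first-order response of the exponential growth rate to a weight \<open>exp a\<close> per unit of
  width of the box; tilting in both directions pins the width from both sides. Only one axis is
  tilted at a time, the other is handled by the same estimate with another \<open>e\<close>.\<close>

definition ip :: "int \<times> int \<Rightarrow> int \<times> int \<Rightarrow> int" where
  "ip e p = fst e * fst p + snd e * snd p"

definition rot :: "int \<times> int \<Rightarrow> int \<times> int" where
  "rot e = (- snd e, fst e)"

definition extent :: "int \<times> int \<Rightarrow> (int \<times> int) list \<Rightarrow> int" where
  "extent e \<pi> = Max (ip e ` set \<pi>)"

text \<open>The distance from the end of the walk to the side of its bounding box facing \<open>e\<close>;
  truncation by \<open>nat\<close> is harmless because the difference is nonnegative.\<close>

definition gap :: "int \<times> int \<Rightarrow> (int \<times> int) list \<Rightarrow> nat" where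
  "gap e \<pi> = nat (extent e \<pi> - ip e (last \<pi>))"

definition width :: "int \<times> int \<Rightarrow> (int \<times> int) list \<Rightarrow> nat" where
  "width e \<pi> = gap e \<pi> + gap (- e) \<pi>"

definition near :: "int \<times> int \<Rightarrow> (int \<times> int) list \<Rightarrow> nat" where
  "near e \<pi> = min (gap e \<pi>) (gap (- e) \<pi>)"

definition allowed :: "(int \<times> int) list \<Rightarrow> (int \<times> int) set" where
  "allowed \<pi> = {d \<in> unit_steps. lattice_ray (last \<pi>) d \<inter> set \<pi> = {}}"

abbreviation grow :: "(int \<times> int) list \<Rightarrow> int \<times> int \<Rightarrow> (int \<times> int) list" where
  "grow \<pi> d \<equiv> \<pi> @ [last \<pi> + d]"

definition last_step :: "(int \<times> int) list \<Rightarrow> int \<times> int" where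
  "last_step \<pi> = last \<pi> - last (butlast \<pi>)"

text \<open>The test refers to the walk before its last step: after the step the gap in front is
  zero also when the walk has merely arrived at an old side.\<close>

definition extends_box :: "(int \<times> int) list \<Rightarrow> bool" where
  "extends_box \<pi> \<longleftrightarrow> gap (last_step \<pi>) (butlast \<pi>) = 0"

lemma unit_stepsE:
  assumes "e \<in> unit_steps"
  obtains "e = (1,0)" | "e = (-1,0)" | "e = (0,1)" | "e = (0,-1)"
  using assms by (auto simp: unit_steps_def)

lemma rot_simps [simp]: "rot (rot e) = - e" "rot (- e) = - rot e"
  by (auto simp: rot_def prod_eq_iff)

lemma unit_steps_uminus [simp]: "- e \<in> unit_steps \<longleftrightarrow> e \<in> unit_steps"
  by (cases e) (auto simp: unit_steps_def)

lemma unit_steps_rot [simp]: "rot e \<in> unit_steps \<longleftrightarrow> e \<in> unit_steps"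
  by (cases e) (auto simp: unit_steps_def rot_def)

lemma unit_steps_eq: "e \<in> unit_steps \<Longrightarrow> unit_steps = {e, rot e, - e, - rot e}"
  by (erule unit_stepsE) (auto simp: unit_steps_def rot_def)

lemma unit_distinct:
  "e \<in> unit_steps \<Longrightarrow> e \<noteq> rot e \<and> e \<noteq> - e \<and> e \<noteq> - rot e \<and> rot e \<noteq> - rot e \<and> rot e \<noteq> - e \<and> rot e \<noteq> e \<and> - e \<noteq> e"
  by (erule unit_stepsE) (auto simp: rot_def)

lemma ip_add: "ip e (p + q) = ip e p + ip e q"
  and ip_diff: "ip e (p - q) = ip e p - ip e q"
  and ip_neg: "ip (- e) p = - ip e p"
  by (auto simp: ip_def algebra_simps)

lemma ip_self: "e \<in> unit_steps \<Longrightarrow> ip e e = 1"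
  and ip_rot: "ip (rot e) e = 0"
  and ip_rot': "ip e (rot e) = 0"
  by (auto simp: ip_def rot_def unit_steps_def)

lemma ip_unit_le: "e \<in> unit_steps \<Longrightarrow> d \<in> unit_steps \<Longrightarrow> \<bar>ip e d\<bar> \<le> 1"
  by (auto simp: ip_def unit_steps_def)

lemma ip_le_extent: "p \<in> set \<pi> \<Longrightarrow> ip e p \<le> extent e \<pi>"
  unfolding extent_def by (rule Max_ge) auto

lemma gap_int: "\<pi> \<noteq> [] \<Longrightarrow> int (gap e \<pi>) = extent e \<pi> - ip e (last \<pi>)"
  unfolding gap_def using ip_le_extent[of "last \<pi>" \<pi> e] by auto

lemma extent_grow: "\<pi> \<noteq> [] \<Longrightarrow> extent e (grow \<pi> d) = max (extent e \<pi>) (ip e (last \<pi>) + ip e d)"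
  unfolding extent_def by (simp add: ip_add max.commute)

lemma gap_grow:
  assumes "\<pi> \<noteq> []"
  shows "int (gap e (grow \<pi> d)) = max (int (gap e \<pi>) - ip e d) 0"
  using gap_int[of "grow \<pi> d" e] gap_int[OF assms, of e] extent_grow[OF assms, of e d]
  by (auto simp: ip_add)

lemma gap_grow_simps:
  assumes "\<pi> \<noteq> []" "d \<in> unit_steps"
  shows "gap d (grow \<pi> d) = gap d \<pi> - 1"
    "gap (- d) (grow \<pi> d) = Suc (gap (- d) \<pi>)"
    "gap (rot d) (grow \<pi> d) = gap (rot d) \<pi>"
    "gap (- rot d) (grow \<pi> d) = gap (- rot d) \<pi>"
  using gap_grow[OF assms(1), of d d] gap_grow[OF assms(1), of "-d" d]
    gap_grow[OF assms(1), of "rot d" d] gap_grow[OF assms(1), of "- rot d" d] assms(2)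
  by (auto simp: ip_neg ip_self ip_rot)

lemma width_grow:
  assumes "\<pi> \<noteq> []" "d \<in> unit_steps"
  shows "width d (grow \<pi> d) = (if gap d \<pi> = 0 then Suc (width d \<pi>) else width d \<pi>)"
    "width (rot d) (grow \<pi> d) = width (rot d) \<pi>"
  using gap_grow_simps[OF assms] by (auto simp: width_def)

lemma width_neg [simp]: "width (- e) \<pi> = width e \<pi>"
  by (simp add: width_def)

lemma near_neg [simp]: "near (- e) \<pi> = near e \<pi>"
  by (simp add: near_def min.commute)

lemma last_step_grow [simp]: "\<pi> \<noteq> [] \<Longrightarrow> last_step (grow \<pi> d) = d"
  by (simp add: last_step_def)

lemma extends_box_grow [simp]: "\<pi> \<noteq> [] \<Longrightarrow> extends_box (grow \<pi> d) \<longleftrightarrow> gap d \<pi> = 0"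
  by (simp add: extends_box_def last_step_def)

text \<open>In the coordinates \<open>ip e\<close> and \<open>ip (rot e)\<close> all four directions
  are treated alike.\<close>

lemma lattice_ray_iff:
  assumes "e \<in> unit_steps"
  shows "q \<in> lattice_ray p e \<longleftrightarrow> ip e q > ip e p \<and> ip (rot e) q = ip (rot e) p"
  using assms
proof (cases rule: unit_stepsE)
  case 1
  then show ?thesis by (cases q, cases p) (auto simp: lattice_ray_def ip_def rot_def intro!: exI[of _ "nat (fst q - fst p)"])
next
  case 2
  then show ?thesis by (cases q, cases p) (auto simp: lattice_ray_def ip_def rot_def intro!: exI[of _ "nat (fst p - fst q)"])
next
  case 3
  then show ?thesis by (cases q, cases p) (auto simp: lattice_ray_def ip_def rot_def intro!: exI[of _ "nat (snd q - snd p)"])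
next
  case 4
  then show ?thesis by (cases q, cases p) (auto simp: lattice_ray_def ip_def rot_def intro!: exI[of _ "nat (snd p - snd q)"])
qed

section \<open>Growing a prudent walk by one allowed step\<close>

lemma prudent_paths_length: "\<pi> \<in> prudent_paths L \<Longrightarrow> length \<pi> = Suc L"
  by (simp add: prudent_paths_def)

lemma prudent_paths_ne: "\<pi> \<in> prudent_paths L \<Longrightarrow> \<pi> \<noteq> []"
  by (auto dest: prudent_paths_length)

lemma prudent_paths_0: "prudent_paths 0 = {[(0, 0)]}"
  by (auto simp: prudent_paths_def length_Suc_conv)

lemma prudent_paths_snoc:
  "\<pi> @ [q] \<in> prudent_paths (Suc L) \<longleftrightarrow> \<pi> \<in> prudent_paths L \<and> q - last \<pi> \<in> allowed \<pi>"
proof (cases "length \<pi> = Suc L")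
  case True
  then have ne: "\<pi> \<noteq> []" by auto
  then have last: "last \<pi> = \<pi> ! L" using True by (simp add: last_conv_nth)
  let ?ok = "\<lambda>\<rho> i. \<rho> ! Suc i - \<rho> ! i \<in> unit_steps \<and>
    lattice_ray (\<rho> ! i) (\<rho> ! Suc i - \<rho> ! i) \<inter> (!) \<rho> ` {0..i} = {}"
  have nth: "(\<pi> @ [q]) ! i = \<pi> ! i" if "i \<le> L" for i
    using that True by (simp add: nth_append)
  have img: "(!) (\<pi> @ [q]) ` {0..i} = (!) \<pi> ` {0..i}" if "i \<le> L" for i
    using that by (intro image_cong) (auto simp: nth)
  have full: "(!) \<pi> ` {0..L} = set \<pi>"
    using True by (auto simp: set_conv_nth image_iff less_Suc_eq_le)
  have "(\<pi> @ [q]) ! Suc L = q" using True by (metis nth_append_length)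
  then have "?ok (\<pi> @ [q]) L \<longleftrightarrow> q - last \<pi> \<in> allowed \<pi>"
    by (simp only: img full nth le_refl last allowed_def mem_Collect_eq)
  moreover have "?ok (\<pi> @ [q]) i \<longleftrightarrow> ?ok \<pi> i" if "i < L" for i
    using that by (simp only: img nth less_imp_le Suc_leI)
  moreover have "(\<pi> @ [q]) ! 0 = \<pi> ! 0" by (simp add: nth)
  ultimately show ?thesis
    using True unfolding prudent_paths_def mem_Collect_eq All_less_Suc by auto
next
  case False
  then show ?thesis by (auto simp: prudent_paths_def)
qed

lemma prudent_paths_Suc:
  "prudent_paths (Suc L) = (\<lambda>(\<pi>, d). grow \<pi> d) ` (SIGMA \<pi>:prudent_paths L. allowed \<pi>)"
proof -
  have "\<exists>\<pi> d. \<rho> = grow \<pi> d \<and> \<pi> \<in> prudent_paths L \<and> d \<in> allowed \<pi>"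
    if "\<rho> \<in> prudent_paths (Suc L)" for \<rho>
  proof -
    have "\<rho> \<noteq> []" using that by (rule prudent_paths_ne)
    then obtain \<pi> q where "\<rho> = \<pi> @ [q]" by (metis rev_exhaust)
    with that show ?thesis by (intro exI[of _ \<pi>] exI[of _ "q - last \<pi>"]) (auto simp: prudent_paths_snoc)
  qed
  then show ?thesis by (fastforce simp: prudent_paths_snoc)
qed

lemma finite_allowed [simp]: "finite (allowed \<pi>)"
  by (simp add: allowed_def unit_steps_def)

lemma sum_prudent_paths_Suc:
  fixes f :: "(int \<times> int) list \<Rightarrow> real"
  shows "sum f (prudent_paths (Suc L)) = (\<Sum>\<pi>\<in>prudent_paths L. \<Sum>d\<in>allowed \<pi>. f (grow \<pi> d))"
proof -
  have "inj_on (\<lambda>(\<pi>, d). grow \<pi> d) (SIGMA \<pi>:prudent_paths L. allowed \<pi>)"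
    by (auto simp: inj_on_def)
  then have "sum f (prudent_paths (Suc L)) =
      (\<Sum>(\<pi>, d)\<in>(SIGMA \<pi>:prudent_paths L. allowed \<pi>). f (grow \<pi> d))"
    unfolding prudent_paths_Suc by (subst sum.reindex) (simp_all add: o_def split_beta)
  also have "\<dots> = (\<Sum>\<pi>\<in>prudent_paths L. \<Sum>d\<in>allowed \<pi>. f (grow \<pi> d))"
    by (subst sum.Sigma) (simp_all add: finite_prudent_paths)
  finally show ?thesis .
qed

lemma allowed_unit: "d \<in> allowed \<pi> \<Longrightarrow> d \<in> unit_steps"
  by (simp add: allowed_def)

lemma allowed_if_gap0:
  assumes "\<pi> \<noteq> []" "f \<in> unit_steps" "gap f \<pi> = 0"
  shows "f \<in> allowed \<pi>"
proof -
  have "p \<notin> lattice_ray (last \<pi>) f" if "p \<in> set \<pi>" for p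
    using ip_le_extent[OF that, of f] gap_int[OF assms(1), of f] assms(2,3) by (simp add: lattice_ray_iff)
  then show ?thesis using assms(2) by (auto simp: allowed_def)
qed

lemma not_allowed_back:
  assumes "\<pi> \<noteq> []" "d \<in> unit_steps"
  shows "- d \<notin> allowed (grow \<pi> d)"
proof -
  have "last \<pi> \<in> lattice_ray (last \<pi> + d) (- d)"
    using assms by (simp add: lattice_ray_iff ip_neg ip_add ip_self ip_rot)
  then show ?thesis using assms by (auto simp: allowed_def)
qed

lemma allowed_straight:
  assumes "\<pi> \<noteq> []" "d \<in> allowed \<pi>"
  shows "d \<in> allowed (grow \<pi> d)"
proof -
  have u: "d \<in> unit_steps" using assms(2) by (rule allowed_unit)
  have "p \<notin> lattice_ray (last \<pi> + d) d" if "p \<in> set (grow \<pi> d)" for p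
  proof -
    have "p \<in> set \<pi> \<Longrightarrow> p \<notin> lattice_ray (last \<pi>) d"
      using assms(2) by (auto simp: allowed_def)
    then show ?thesis using that u by (auto simp: lattice_ray_iff ip_add ip_self ip_rot)
  qed
  then show ?thesis using u by (auto simp: allowed_def)
qed

text \<open>A discrete intermediate value argument: one step changes the coordinate by at most one,
  so no level between the endpoint and the maximum is skipped.\<close>

lemma path_hits_level:
  assumes "\<pi> \<in> prudent_paths L" "e \<in> unit_steps" "ip e (last \<pi>) \<le> v" "v \<le> extent e \<pi>"
  shows "\<exists>s\<in>set \<pi>. ip e s = v"
  using assms(1,3,4)
proof (induction L arbitrary: \<pi> v)
  case 0
  then show ?case by (auto simp: prudent_paths_0 extent_def)
next
  case (Suc L)
  then obtain \<pi>' d where \<pi>: "\<pi> = grow \<pi>' d" "\<pi>' \<in> prudent_paths L" "d \<in> allowed \<pi>'"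
    by (auto simp: prudent_paths_Suc)
  have ne: "\<pi>' \<noteq> []" using \<pi>(2) by (rule prudent_paths_ne)
  have "\<bar>ip e d\<bar> \<le> 1" using assms(2) \<pi>(3) by (auto intro: ip_unit_le allowed_unit)
  then show ?case
    using Suc.IH[OF \<pi>(2), of v] Suc.prems \<pi>(1) extent_grow[OF ne, of e d]
    by (cases "v = ip e (last \<pi>)") (auto simp: ip_add)
qed

text \<open>The new endpoint lies strictly beyond all earlier sites in direction \<open>d\<close>,
  so both sideways rays are free, while the way back meets the previous site.\<close>

lemma allowed_extends_box:
  assumes "\<pi> \<noteq> []" "d \<in> allowed \<pi>" "gap d \<pi> = 0"
  shows "allowed (grow \<pi> d) = {d, rot d, - rot d}"
proof -
  have u: "d \<in> unit_steps" using assms by (auto intro: allowed_unit)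
  have lt: "ip d p < ip d (last \<pi> + d)" if "p \<in> set \<pi>" for p
    using ip_le_extent[OF that, of d] gap_int[OF assms(1), of d] assms(3) u
    by (auto simp: ip_add ip_self)
  have "f \<in> allowed (grow \<pi> d)" if f: "f = rot d \<or> f = - rot d" for f
  proof -
    have "p \<notin> lattice_ray (last \<pi> + d) f" if "p \<in> set (grow \<pi> d)" for p
      using that lt[of p] f u by (auto simp: lattice_ray_iff ip_neg)
    then show ?thesis using f u by (auto simp: allowed_def)
  qed
  then show ?thesis
    using allowed_straight[OF assms(1,2)] not_allowed_back[OF assms(1) u]
      unit_steps_eq[OF u] allowed_unit by blast
qed

lemma extends_box_state:
  assumes "\<pi> \<in> prudent_paths (Suc L)" "extends_box \<pi>"
  shows "last_step \<pi> \<in> unit_steps" "gap (last_step \<pi>) \<pi> = 0" "gap (- last_step \<pi>) \<pi> \<ge> 1"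
    "allowed \<pi> = {last_step \<pi>, rot (last_step \<pi>), - rot (last_step \<pi>)}"
proof -
  obtain \<pi>' d where \<pi>: "\<pi> = grow \<pi>' d" "\<pi>' \<in> prudent_paths L" "d \<in> allowed \<pi>'"
    using assms by (auto simp: prudent_paths_Suc)
  have ne: "\<pi>' \<noteq> []" using \<pi>(2) by (rule prudent_paths_ne)
  have d: "d \<in> unit_steps" using \<pi>(3) by (rule allowed_unit)
  have g: "gap d \<pi>' = 0" using assms(2) \<pi>(1) ne by simp
  show "last_step \<pi> \<in> unit_steps" "gap (last_step \<pi>) \<pi> = 0" "gap (- last_step \<pi>) \<pi> \<ge> 1"
    "allowed \<pi> = {last_step \<pi>, rot (last_step \<pi>), - rot (last_step \<pi>)}"
    using \<pi>(1) ne d g gap_grow_simps[OF ne d] allowed_extends_box[OF ne \<pi>(3) g] by auto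
qed

text \<open>A step that does not push a side of the box outwards runs along a side \<open>f\<close>; the walk may then
  only go straight on or leave the box through \<open>f\<close>, since by connectedness the opposite ray
  meets a site visited earlier in the same column.\<close>

lemma not_extends_box_state:
  assumes "\<pi> \<in> prudent_paths (Suc L)" "\<not> extends_box \<pi>"
  shows "\<exists>f\<in>{rot (last_step \<pi>), - rot (last_step \<pi>)}. gap f \<pi> = 0 \<and> gap (- f) \<pi> \<ge> 1 \<and> allowed \<pi> = {last_step \<pi>, f}"
  using assms
proof (induction L arbitrary: \<pi>)
  case 0
  then obtain d where "\<pi> = grow [(0,0)] d" "d \<in> allowed [(0,0)]"
    by (auto simp: prudent_paths_Suc prudent_paths_0)
  moreover have "extends_box (grow [(0,0)] d)" for d
    by (subst extends_box_grow) (auto simp: gap_def extent_def)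
  ultimately have "extends_box \<pi>" by metis
  with 0 show ?case by simp
next
  case (Suc L)
  then obtain \<pi>' d where \<pi>: "\<pi> = grow \<pi>' d" "\<pi>' \<in> prudent_paths (Suc L)" "d \<in> allowed \<pi>'"
    by (auto simp: prudent_paths_Suc[of "Suc L"])
  have ne: "\<pi>' \<noteq> []" using \<pi>(2) by (rule prudent_paths_ne)
  have d: "d \<in> unit_steps" using \<pi>(3) by (rule allowed_unit)
  have last_step: "last_step \<pi> = d" using \<pi> ne by simp
  have g: "gap d \<pi>' > 0" using Suc.prems(2) \<pi>(1) ne by simp
  \<comment> \<open>After a push the wall is the side just pushed. After a step along a wall the
    wall is inherited, since a turn towards it would push the box, against \<open>g\<close>.\<close>
  have "\<exists>f\<in>{rot d, - rot d}. gap f \<pi>' = 0 \<and> gap (- f) \<pi>' \<ge> 1"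
  proof (cases "extends_box \<pi>'")
    case True
    note s = extends_box_state[OF \<pi>(2) True]
    have "d = rot (last_step \<pi>') \<or> d = - rot (last_step \<pi>')"
      using s \<pi>(3) g by auto
    then show ?thesis using s by auto
  next
    case False
    obtain f where f: "f\<in>{rot (last_step \<pi>'), - rot (last_step \<pi>')}" "gap f \<pi>' = 0" "gap (- f) \<pi>' \<ge> 1" "allowed \<pi>' = {last_step \<pi>', f}"
      using Suc.IH[OF \<pi>(2) False] by blast
    have "d = last_step \<pi>'" using f \<pi>(3) g by auto
    then show ?thesis using f by auto
  qed
  then obtain f where f: "f \<in> {rot d, - rot d}" "gap f \<pi>' = 0" "gap (- f) \<pi>' \<ge> 1" by blast
  have fu: "f \<in> unit_steps" using f d by auto
  have gf: "gap f \<pi> = 0" "gap (- f) \<pi> \<ge> 1"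
    using f gap_grow_simps[OF ne d] \<pi>(1) by auto
  have "f \<in> allowed \<pi>" using gf fu \<pi>(1) by (intro allowed_if_gap0) auto
  moreover have "- f \<notin> allowed \<pi>"
  proof -
    have "\<exists>s\<in>set \<pi>'. ip d s = ip d (last \<pi>' + d)"
      using g gap_int[OF ne, of d] d
      by (intro path_hits_level[OF \<pi>(2) d]) (auto simp: ip_add ip_self)
    then obtain s where s: "s \<in> set \<pi>'" "ip d s = ip d (last \<pi>' + d)" by blast
    \<comment> \<open>Prudence of the last step keeps \<open>s\<close> off the row just walked
      along, and no site lies beyond the wall \<open>f\<close>; hence \<open>s\<close> is on the ray
      in direction \<open>- f\<close>.\<close>
    have "s \<notin> lattice_ray (last \<pi>') d" using \<pi>(3) s(1) by (auto simp: allowed_def)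
    then have "ip (rot d) s \<noteq> ip (rot d) (last \<pi>')"
      using s(2) d by (auto simp: lattice_ray_iff ip_add ip_self)
    then have "ip f s \<noteq> ip f (last \<pi>)"
      using f(1) \<pi>(1) by (auto simp: ip_neg ip_add ip_rot)
    moreover have "ip f s \<le> ip f (last \<pi>)"
      using gf(1) gap_int[of \<pi> f] ip_le_extent[of s \<pi> f] s(1) \<pi>(1) by auto
    ultimately have "s \<in> lattice_ray (last \<pi>) (- f)"
      using fu s(2) f(1) \<pi>(1) by (auto simp: lattice_ray_iff ip_neg)
    then show ?thesis using s(1) \<pi>(1) by (auto simp: allowed_def)
  qed
  moreover have "d \<in> allowed \<pi>" using allowed_straight[OF ne \<pi>(3)] \<pi>(1) by simp
  moreover have "- d \<notin> allowed \<pi>" using not_allowed_back[OF ne d] \<pi>(1) by simp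
  moreover have "unit_steps = {d, - d, f, - f}" unfolding unit_steps_eq[OF d] using f(1) by auto
  ultimately have "allowed \<pi> = {d, f}" using allowed_unit by blast
  then show ?case unfolding last_step using f(1) gf by (intro bexI[of _ f]) simp_all
qed

section \<open>A supersolution of the transfer equations\<close>

text \<open>
  A phase is a maximal stretch of the walk during which the box only grows in one direction; the
  Boolean says whether that direction lies along the tilted axis. A step pushing the box has weight
  \<open>U\<close>, any other step has weight \<open>z\<close>. In a half plane, the total weight of the continuations
  until the phase ends at the corner at distance \<open>i\<close> is proportional to \<open>\<rho> ^ i\<close> with
  \<open>\<rho> = z (1 + F)\<close>, where \<open>F\<close> is the weight of a phase from a corner back to itself and
  \<open>U = F (1 - z \<rho>) / ((1 + F) (1 - z\<^sup>2))\<close>. The sum \<open>\<rho> ^ i + \<rho> ^ j\<close> accounts for both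
  corners, the error \<open>\<rho> ^ A\<close> made in a box of finite size is absorbed by the decreasing factor
  \<open>g\<close>, and the term with \<open>m\<close> pays for ending far from all corners.
\<close>

locale supersolution =
  fixes z \<beta> \<kappa> :: real and U F X :: "bool \<Rightarrow> real"
  assumes z_pos: "0 < z" and \<beta>_ge: "1 \<le> \<beta>" and z\<beta>: "z * \<beta> < 1" and \<kappa>_pos: "0 < \<kappa>"
    and U_pos: "0 < U b" and F_pos: "0 < F b" and X_pos: "0 < X b"
    and \<rho>_le: "z * (1 + F b) \<le> 9 / 10"
    and U_le: "U b * ((1 + F b) * (1 - z\<^sup>2)) \<le> F b * (1 - z\<^sup>2 * (1 + F b))"
    and U_lat: "U b * (1 + z * \<beta>) \<le> 1 - z * \<beta>"
    and X_exit: "X (\<not> b) * F (\<not> b) + U (\<not> b) * \<kappa> \<le> X b"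
begin

definition \<rho> :: "bool \<Rightarrow> real" where "\<rho> b = z * (1 + F b)"
text \<open>The share of the corner which the walk is moving away from: it pushes, with weight
  \<open>F b\<close>, or takes one more step, with weight \<open>z\<close> and distance increased by
  one. \<open>q_eq\<close> is this recursion.\<close>

definition q :: "bool \<Rightarrow> real" where "q b = F b / (1 - z * \<rho> b)"
text \<open>The analogous geometric series for the \<open>m\<close> term, where a further sideways
  step costs at most \<open>z * \<beta>\<close> by \<open>m_shift\<close>.\<close>

definition p :: "bool \<Rightarrow> real" where "p b = U b / (1 - z * \<beta>)"
text \<open>Since 10 is \<open>1 / (1 - 9 / 10)\<close>, the ratio \<open>g n / g (Suc n)\<close> is
  exactly \<open>exp ((9 / 10) ^ n)\<close>, which dominates \<open>1 + \<rho> b ^ n\<close>; yet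
  \<open>g\<close> stays between 1 and \<open>exp 10\<close>.\<close>

definition g :: "nat \<Rightarrow> real" where "g n = exp (10 * (9 / 10) ^ n)"
text \<open>The \<open>Suc\<close> is made for the change of phase. There \<open>(A, j)\<close>
  becomes \<open>(Suc j, A)\<close>, so the factor \<open>g (Suc j)\<close> is unchanged and
  \<open>g A\<close> turns into \<open>g (Suc A)\<close>, which is the gain needed.\<close>

definition x :: "bool \<Rightarrow> nat \<Rightarrow> nat \<Rightarrow> real" where "x b A B = X b * g A * g (Suc B)"
definition m :: "nat \<Rightarrow> nat \<Rightarrow> real" where "m i j = min (\<beta> ^ i) (\<beta> ^ j)"

text \<open>
  \<open>Ev b A i j\<close> is the value just after a step pushing the box and \<open>Lv b A i j\<close> the one after a
  step along a side: \<open>A\<close> is the extent of the box in the direction of the phase, \<open>i\<close> and \<open>j\<close>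
  are the distances to the two corners, and for \<open>Lv\<close> the walk moves towards the corner at
  distance \<open>i\<close>.
\<close>

definition Ev :: "bool \<Rightarrow> nat \<Rightarrow> nat \<Rightarrow> nat \<Rightarrow> real" where
  "Ev b A i j = x b A (i + j) * F b / U b * (\<rho> b ^ i + \<rho> b ^ j) + \<kappa> * m i j"

definition Lv :: "bool \<Rightarrow> nat \<Rightarrow> nat \<Rightarrow> nat \<Rightarrow> real" where
  "Lv b A i j = x b A (i + j) * (\<rho> b ^ i * (1 + F b) + q b * \<rho> b ^ j) + \<kappa> * p b * m i j"

definition Sv :: "bool \<Rightarrow> nat \<Rightarrow> nat \<Rightarrow> nat \<Rightarrow> real" where
  "Sv b A i j = (if i = 0 then U (\<not> b) * Ev (\<not> b) (Suc j) A 0 else z * Lv b A (i - 1) (Suc j))"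

lemma z_lt1: "z < 1"
proof -
  have "z * 1 \<le> z * \<beta>" using \<beta>_ge z_pos by (intro mult_left_mono) auto
  then show ?thesis using z\<beta> by linarith
qed

lemma \<rho>_pos: "0 < \<rho> b" unfolding \<rho>_def using z_pos F_pos[of b] by simp

lemma \<rho>_le': "\<rho> b \<le> 9 / 10" unfolding \<rho>_def by (rule \<rho>_le)

lemma z\<rho>: "z * \<rho> b < 1"
  using mult_strict_mono[of z 1 "\<rho> b" 1] z_lt1 \<rho>_le'[of b] \<rho>_pos[of b] by simp

lemma q_eq: "F b = q b - z * \<rho> b * q b"
proof -
  have "q b * (1 - z * \<rho> b) = F b" unfolding q_def using z\<rho>[of b] by simp
  then show ?thesis by (simp add: algebra_simps)
qed

lemma q_pos: "0 < q b" unfolding q_def using z\<rho>[of b] F_pos[of b] by simp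

lemma p_eq: "U b = p b - z * \<beta> * p b"
proof -
  have "p b * (1 - z * \<beta>) = U b" unfolding p_def using z\<beta> by simp
  then show ?thesis by (simp add: algebra_simps)
qed

lemma p_pos: "0 < p b" unfolding p_def using z\<beta> U_pos[of b] by simp

lemma g_ge1: "1 \<le> g n" unfolding g_def by simp

lemma g_step: "(1 + \<rho> b ^ n) * g (Suc n) \<le> g n"
proof -
  have "g n = exp ((9 / 10) ^ n) * g (Suc n)"
    unfolding g_def by (simp flip: exp_add)
  moreover have "1 + \<rho> b ^ n \<le> exp ((9 / 10) ^ n)"
    using power_mono[OF \<rho>_le'[of b], of n] \<rho>_pos[of b] exp_ge_add_one_self[of "(9 / 10) ^ n"] by linarith
  ultimately show ?thesis using g_ge1[of "Suc n"] by (simp add: mult_right_mono)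
qed

lemma g_antimono: "g (Suc n) \<le> g n"
  unfolding g_def by (simp add: mult_le_cancel_left1)

lemma x_pos: "0 < x b A B"
  unfolding x_def using X_pos[of b] by (simp add: g_def)

lemma x_Suc: "x b (Suc A) B \<le> x b A B"
  unfolding x_def using g_antimono[of A] X_pos[of b] g_ge1[of "Suc B"]
  by (intro mult_right_mono mult_left_mono) auto

lemma m_pos: "0 < m i j"
  unfolding m_def using \<beta>_ge by (simp add: min_def)

lemma m_shift: "m i (Suc j) \<le> \<beta> * m (Suc i) j"
proof -
  have "\<beta> ^ i \<le> \<beta> * \<beta> ^ Suc i" using \<beta>_ge power_increasing[of i "Suc (Suc i)" \<beta>] by simp
  then have "min (\<beta> ^ i) (\<beta> ^ Suc j) \<le> min (\<beta> * \<beta> ^ Suc i) (\<beta> * \<beta> ^ j)" by auto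
  also have "\<dots> = \<beta> * min (\<beta> ^ Suc i) (\<beta> ^ j)" using \<beta>_ge by (simp add: min_mult_distrib_left)
  finally show ?thesis by (simp add: m_def)
qed

text \<open>When a new phase starts at a corner, its other corner at distance \<open>A\<close>
  contributes an unwanted \<open>\<rho> ^ A\<close>, which \<open>g_step\<close> absorbs. As
  \<open>m A 0\<close> is at most 1, the \<kappa> term fits into \<open>X_exit\<close>.\<close>

lemma exit_le: "U (\<not> b) * Ev (\<not> b) (Suc j) A 0 \<le> x b A j"
proof -
  have "U (\<not> b) * Ev (\<not> b) (Suc j) A 0 =
     x (\<not> b) (Suc j) A * F (\<not> b) * (1 + \<rho> (\<not> b) ^ A) + U (\<not> b) * \<kappa> * m A 0"
    unfolding Ev_def using U_pos[of "\<not> b"] by (simp add: field_simps)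
  also have "x (\<not> b) (Suc j) A * F (\<not> b) * (1 + \<rho> (\<not> b) ^ A) =
     X (\<not> b) * F (\<not> b) * g (Suc j) * ((1 + \<rho> (\<not> b) ^ A) * g (Suc A))"
    by (simp add: x_def)
  also have "\<dots> \<le> X (\<not> b) * F (\<not> b) * g (Suc j) * g A"
    using g_step X_pos[of "\<not> b"] F_pos[of "\<not> b"] g_ge1[of "Suc j"] by (intro mult_left_mono) auto
  also have "U (\<not> b) * \<kappa> * m A 0 \<le> U (\<not> b) * \<kappa> * (g (Suc j) * g A)"
  proof (intro mult_left_mono)
    have "m A 0 \<le> 1" by (simp add: m_def)
    also have "1 \<le> g (Suc j) * g A" using g_ge1[of "Suc j"] g_ge1[of A] mult_mono[of 1 "g (Suc j)" 1 "g A"] by simp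
    finally show "m A 0 \<le> g (Suc j) * g A" .
  qed (use U_pos[of "\<not> b"] \<kappa>_pos in auto)
  also have "X (\<not> b) * F (\<not> b) * g (Suc j) * g A + U (\<not> b) * \<kappa> * (g (Suc j) * g A) =
      (X (\<not> b) * F (\<not> b) + U (\<not> b) * \<kappa>) * (g (Suc j) * g A)"
    by (simp add: algebra_simps)
  also have "\<dots> \<le> X b * (g (Suc j) * g A)"
    using X_exit[of b] g_ge1[of "Suc j"] g_ge1[of A] by (intro mult_right_mono) auto
  also have "\<dots> = x b A j" by (simp add: x_def)
  finally show ?thesis by simp
qed

text \<open>The cases share one bound because the exit value is normalised to
  \<open>\<rho> b ^ 0\<close>, and away from the corner \<open>z * (1 + F b) = \<rho> b\<close>
  reproduces the power.\<close>

lemma Sv_le: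
  "Sv b A i j \<le> x b A (i + j) * (\<rho> b ^ i + z * \<rho> b * q b * \<rho> b ^ j) + z * \<beta> * p b * (\<kappa> * m i j)"
proof (cases i)
  case 0
  have "0 \<le> x b A j * (z * \<rho> b * q b * \<rho> b ^ j) + z * \<beta> * p b * (\<kappa> * m 0 j)"
    using x_pos[of b A j] z_pos \<rho>_pos[of b] q_pos[of b] \<beta>_ge p_pos[of b] \<kappa>_pos m_pos[of 0 j]
    by (intro add_nonneg_nonneg mult_nonneg_nonneg zero_le_power) auto
  then show ?thesis using exit_le[of b j A] 0 by (simp add: Sv_def algebra_simps)
next
  case (Suc k)
  have "Sv b A i j = x b A (i + j) * (z * \<rho> b ^ k * (1 + F b) + z * q b * \<rho> b ^ Suc j)
      + z * p b * \<kappa> * m k (Suc j)"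
    using Suc by (simp add: Sv_def Lv_def algebra_simps)
  also have "z * \<rho> b ^ k * (1 + F b) = \<rho> b ^ i" using Suc by (simp add: \<rho>_def)
  also have "z * p b * \<kappa> * m k (Suc j) \<le> z * p b * \<kappa> * (\<beta> * m i j)"
    using m_shift[of k j] Suc z_pos p_pos[of b] \<kappa>_pos by (intro mult_left_mono) auto
  finally show ?thesis by (simp add: algebra_simps)
qed

lemma U_Ev_le:
  "U b * Ev b (Suc A) i j \<le> x b A (i + j) * F b * (\<rho> b ^ i + \<rho> b ^ j) + U b * (\<kappa> * m i j)"
proof -
  have "U b * Ev b (Suc A) i j = x b (Suc A) (i + j) * (F b * (\<rho> b ^ i + \<rho> b ^ j)) + U b * (\<kappa> * m i j)"
    unfolding Ev_def using U_pos[of b] by (simp add: field_simps)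
  also have "\<dots> \<le> x b A (i + j) * (F b * (\<rho> b ^ i + \<rho> b ^ j)) + U b * (\<kappa> * m i j)"
    using x_Suc F_pos[of b] \<rho>_pos[of b] U_pos[of b] \<kappa>_pos m_pos[of i j] by (intro add_mono mult_right_mono) (auto intro!: mult_nonneg_nonneg add_nonneg_nonneg)
  finally show ?thesis by (simp add: mult.assoc)
qed

lemma Lv_super: "U b * Ev b (Suc A) i j + Sv b A i j \<le> Lv b A i j"
proof -
  have *: "y * f * (u + v) + U' * k + (y * (u + zr * q' * v * 1 + 0 * f) + zb * p' * k) =
     y * (u * (1 + f) + q' * v) + k * p'"
    if "f = q' - zr * q'" "U' = p' - zb * p'" for y f u v U' k zr zb q' p' :: real
    unfolding that by (simp add: algebra_simps)
  have "U b * Ev b (Suc A) i j + Sv b A i j \<le> Lv b A i j"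
    if "F b = q b - z * \<rho> b * q b" "U b = p b - z * \<beta> * p b"
    using add_mono[OF U_Ev_le[of b A i j] Sv_le[of b A i j]]
      *[OF that, of "x b A (i + j)" "\<rho> b ^ i" "\<rho> b ^ j" "\<kappa> * m i j"]
    unfolding Lv_def by (simp add: algebra_simps)
  then show ?thesis using q_eq p_eq by blast
qed

text \<open>For one fixed corner the left side adds the weights of pushing, of turning towards it
  and of turning away from it; the comparison is \<open>U_le\<close> rewritten.\<close>

lemma F_div_U: "F b + 1 + z * \<rho> b * q b \<le> F b / U b"
proof -
  have d: "1 - z\<^sup>2 * (1 + F b) > 0" using z\<rho>[of b] by (simp add: \<rho>_def power2_eq_square mult.assoc)
  have "F b + 1 + z * \<rho> b * q b = 1 + q b" using q_eq[of b] by simp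
  also have "\<dots> = 1 + F b / (1 - z\<^sup>2 * (1 + F b))"
    by (simp add: q_def \<rho>_def power2_eq_square mult.assoc)
  also have "\<dots> = (1 + F b) * (1 - z\<^sup>2) / (1 - z\<^sup>2 * (1 + F b))"
    using d by (simp add: field_simps)
  also have "\<dots> \<le> F b / U b"
    using U_le[of b] d U_pos[of b] by (simp add: divide_le_eq le_divide_eq mult.commute mult.left_commute)
  finally show ?thesis .
qed

lemma p_lat: "U b + 2 * (z * \<beta> * p b) \<le> 1"
proof -
  have "U b + 2 * (z * \<beta> * p b) = U b * (1 + z * \<beta>) / (1 - z * \<beta>)"
    unfolding p_def using z\<beta> by (simp add: field_simps)
  also have "\<dots> \<le> 1" using U_lat[of b] z\<beta> by simp
  finally show ?thesis .
qed

lemma Ev_super: "U b * Ev b (Suc A) i j + Sv b A i j + Sv b A j i \<le> Ev b A i j"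
proof -
  let ?y = "x b A (i + j)" and ?r = "\<rho> b ^ i + \<rho> b ^ j"
  have "U b * Ev b (Suc A) i j + Sv b A i j + Sv b A j i \<le>
      (?y * F b * ?r + U b * (\<kappa> * m i j)) +
      (?y * (\<rho> b ^ i + z * \<rho> b * q b * \<rho> b ^ j) + z * \<beta> * p b * (\<kappa> * m i j)) +
      (?y * (\<rho> b ^ j + z * \<rho> b * q b * \<rho> b ^ i) + z * \<beta> * p b * (\<kappa> * m i j))"
  proof -
    have "m j i = m i j" "j + i = i + j" by (simp_all add: m_def min.commute)
    then show ?thesis
      using U_Ev_le[of b A i j] Sv_le[of b A i j] Sv_le[of b A j i] by (simp only:)
  qed
  also have "\<dots> = (F b + 1 + z * \<rho> b * q b) * (?y * ?r) + (U b + 2 * (z * \<beta> * p b)) * (\<kappa> * m i j)"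
    by (simp add: algebra_simps)
  also have "\<dots> \<le> F b / U b * (?y * ?r) + 1 * (\<kappa> * m i j)"
    using F_div_U p_lat x_pos[of b A "i + j"] \<rho>_pos[of b] \<kappa>_pos m_pos[of i j]
    by (intro add_mono mult_right_mono) (auto intro!: mult_nonneg_nonneg add_nonneg_nonneg)
  also have "\<dots> = Ev b A i j" by (simp add: Ev_def)
  finally show ?thesis .
qed

lemma Ev_ge: "\<kappa> * m i j \<le> Ev b A i j"
  unfolding Ev_def using x_pos[of b A "i + j"] F_pos[of b] U_pos[of b] \<rho>_pos[of b] by simp

lemma Lv_ge: "\<kappa> * p b * m i j \<le> Lv b A i j"
  unfolding Lv_def using x_pos[of b A "i + j"] F_pos[of b] q_pos[of b] \<rho>_pos[of b] by simp

lemma Ev_commute: "Ev b A i j = Ev b A j i"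
  by (simp add: Ev_def m_def add.commute min.commute)

end

section \<open>From walks to box states, and the tilted sums\<close>

definition par :: "int \<times> int \<Rightarrow> int \<times> int \<Rightarrow> bool" where
  "par e d \<longleftrightarrow> d = e \<or> d = - e"

text \<open>After a step along a side the phase axis is perpendicular to the last step, hence
  \<open>\<not> par e l\<close> and \<open>width (rot l)\<close>. After a push neither side corner
  is distinguished; their order depends on the orientation of \<open>l\<close>, so the transfer
  lemmas ask for a symmetric \<open>E\<close>.\<close>

definition state_val ::
  "int \<times> int \<Rightarrow> (bool \<Rightarrow> nat \<Rightarrow> nat \<Rightarrow> nat \<Rightarrow> real) \<Rightarrow> (bool \<Rightarrow> nat \<Rightarrow> nat \<Rightarrow> nat \<Rightarrow> real) \<Rightarrow> (int \<times> int) list \<Rightarrow> real" where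
  "state_val e E L \<pi> = (let l = last_step \<pi> in
     if extends_box \<pi> then E (par e l) (width l \<pi>) (gap (rot l) \<pi>) (gap (- rot l) \<pi>)
     else L (\<not> par e l) (width (rot l) \<pi>) (gap l \<pi>) (gap (- l) \<pi>))"

text \<open>At \<open>i = 0\<close> the sideways step pushes the box and opens a phase of the other
  kind: the pushed width becomes \<open>Suc j\<close>, and the walk is at distance 0 from one corner
  of the new phase and \<open>A\<close> from the other.\<close>

definition lateral_val ::
  "(bool \<Rightarrow> real) \<Rightarrow> real \<Rightarrow> (bool \<Rightarrow> nat \<Rightarrow> nat \<Rightarrow> nat \<Rightarrow> real) \<Rightarrow> (bool \<Rightarrow> nat \<Rightarrow> nat \<Rightarrow> nat \<Rightarrow> real) \<Rightarrow>
    bool \<Rightarrow> nat \<Rightarrow> nat \<Rightarrow> nat \<Rightarrow> real" where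
  "lateral_val U z E L b A i j =
     (if i = 0 then U (\<not> b) * E (\<not> b) (Suc j) A 0 else z * L b A (i - 1) (Suc j))"

definition step_weight :: "int \<times> int \<Rightarrow> (bool \<Rightarrow> real) \<Rightarrow> real \<Rightarrow> (int \<times> int) list \<Rightarrow> int \<times> int \<Rightarrow> real" where
  "step_weight e U z \<pi> d = (if gap d \<pi> = 0 then U (par e d) else z)"

lemma unit_cases:
  "d \<in> unit_steps \<Longrightarrow> e \<in> unit_steps \<Longrightarrow> (e = d \<or> e = - d) \<or> (e = rot d \<or> e = - rot d)"
  using unit_steps_eq[of d] by blast

lemma par_neg [simp]: "par e (- d) = par e d"
  unfolding par_def by (metis minus_equation_iff)

lemma par_rot [simp]:
  assumes "e \<in> unit_steps" "d \<in> unit_steps"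
  shows "par e (rot d) \<longleftrightarrow> \<not> par e d"
  by (rule unit_stepsE[OF assms(1)]; rule unit_stepsE[OF assms(2)]; simp add: par_def rot_def)

lemma state_val_grow:
  assumes "\<pi> \<noteq> []" "d \<in> unit_steps"
  shows "state_val e E L (grow \<pi> d) =
    (if gap d \<pi> = 0 then E (par e d) (Suc (width d \<pi>)) (gap (rot d) \<pi>) (gap (- rot d) \<pi>)
     else L (\<not> par e d) (width (rot d) \<pi>) (gap d \<pi> - 1) (Suc (gap (- d) \<pi>)))"
  using assms by (simp add: state_val_def gap_grow_simps width_grow Let_def)

lemma state_val_lateral:
  assumes "\<pi> \<noteq> []" "d \<in> unit_steps" "e \<in> unit_steps"
    and sym: "\<And>b A i j. E b A i j = E b A j i"
    and "gap (rot d) \<pi> = 0 \<or> gap (- rot d) \<pi> = 0"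
  shows "step_weight e U z \<pi> d * state_val e E L (grow \<pi> d) =
    lateral_val U z E L (\<not> par e d) (width (rot d) \<pi>) (gap d \<pi>) (gap (- d) \<pi>)"
  using assms(5) state_val_grow[OF assms(1,2), of e E L] sym[of "par e d" _ 0]
  by (auto simp: step_weight_def lateral_val_def width_def)

lemma sum_state_val:
  assumes \<pi>: "\<pi> \<in> prudent_paths (Suc L)" and e: "e \<in> unit_steps"
    and sym: "\<And>b A i j. E b A i j = E b A j i"
    and l: "l = last_step \<pi>"
  shows "(\<Sum>d\<in>allowed \<pi>. step_weight e U z \<pi> d * state_val e E La (grow \<pi> d)) =
    (if extends_box \<pi> then
       let b = par e l; A = width l \<pi>; i = gap (rot l) \<pi>; j = gap (- rot l) \<pi> in
       U b * E b (Suc A) i j + lateral_val U z E La b A i j + lateral_val U z E La b A j i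
     else
       let b = \<not> par e l; A = width (rot l) \<pi>; i = gap l \<pi>; j = gap (- l) \<pi> in
       U b * E b (Suc A) i j + lateral_val U z E La b A i j)"
    (is "sum ?w _ = _")
proof -
  have ne: "\<pi> \<noteq> []" using \<pi> by (rule prudent_paths_ne)
  show ?thesis
  proof (cases "extends_box \<pi>")
    case True
    note s = extends_box_state[OF \<pi> True, folded l]
    have al: "allowed \<pi> = {l, rot l, - rot l}" by (rule s(4))
    have "sum ?w (allowed \<pi>) = ?w l + ?w (rot l) + ?w (- rot l)"
      unfolding al using unit_distinct[OF s(1)] by simp
    moreover have "?w l = U (par e l) * E (par e l) (Suc (width l \<pi>)) (gap (rot l) \<pi>) (gap (- rot l) \<pi>)"
      using s state_val_grow[OF ne s(1)] by (simp add: step_weight_def)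
    moreover have "?w (rot l) = lateral_val U z E La (par e l) (width l \<pi>) (gap (rot l) \<pi>) (gap (- rot l) \<pi>)"
      using state_val_lateral[OF ne _ e sym, of "rot l"] s e by simp
    moreover have "?w (- rot l) = lateral_val U z E La (par e l) (width l \<pi>) (gap (- rot l) \<pi>) (gap (rot l) \<pi>)"
      using state_val_lateral[OF ne _ e sym, of "- rot l"] s e by simp
    ultimately show ?thesis using True by (simp add: Let_def)
  next
    case False
    obtain f where f: "f \<in> {rot l, - rot l}" "gap f \<pi> = 0" and al: "allowed \<pi> = {l, f}"
      using not_extends_box_state[OF \<pi> False, folded l] by blast
    have u: "l \<in> unit_steps" "f \<in> unit_steps" using al allowed_unit by blast+
    have "sum ?w (allowed \<pi>) = ?w l + ?w f"
      unfolding al using unit_distinct[OF u(1)] f(1) by auto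
    moreover have "?w f = U (\<not> par e l) * E (\<not> par e l) (Suc (width (rot l) \<pi>)) (gap l \<pi>) (gap (- l) \<pi>)"
      using f(1)
    proof
      assume "f = rot l"
      then show ?thesis using f(2) u e sym state_val_grow[OF ne u(2), of e E La] by (simp add: step_weight_def)
    next
      assume "f \<in> {- rot l}"
      then show ?thesis using f(2) u e state_val_grow[OF ne u(2), of e E La] by (simp add: step_weight_def)
    qed
    moreover have "?w l = lateral_val U z E La (\<not> par e l) (width (rot l) \<pi>) (gap l \<pi>) (gap (- l) \<pi>)"
      using f by (intro state_val_lateral[OF ne u(1) e sym]) auto
    ultimately show ?thesis using False by (simp add: Let_def)
  qed
qed

lemma exp_width_grow:
  assumes "\<pi> \<noteq> []" "d \<in> unit_steps" "e \<in> unit_steps"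
    and "U = (\<lambda>b. z * (if b then exp a else 1))"
  shows "z * exp (a * real (width e (grow \<pi> d))) = exp (a * real (width e \<pi>)) * step_weight e U z \<pi> d"
proof (cases "par e d")
  case True
  then have "width e \<rho> = width d \<rho>" for \<rho>
    using width_neg[of d] width_neg[of e] by (auto simp: par_def)
  then show ?thesis using True assms width_grow[OF assms(1,2)]
    by (simp add: step_weight_def algebra_simps exp_add)
next
  case False
  then have "e = rot d \<or> e = - rot d"
    using unit_cases[OF assms(2,3)] by (auto simp: par_def)
  then have "width e \<rho> = width (rot d) \<rho>" for \<rho>
    by auto
  then show ?thesis using False assms width_grow[OF assms(1,2)]
    by (simp add: step_weight_def)
qed

text \<open>At every time the walk sits on a side of its box, so only one of the two axes can be far from both sides.\<close>

lemma near_state: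
  assumes "\<pi> \<in> prudent_paths (Suc L)" "e \<in> unit_steps" "l = last_step \<pi>"
  shows "extends_box \<pi> \<Longrightarrow> near e \<pi> \<le> min (gap (rot l) \<pi>) (gap (- rot l) \<pi>)"
    "\<not> extends_box \<pi> \<Longrightarrow> near e \<pi> \<le> min (gap l \<pi>) (gap (- l) \<pi>)"
proof -
  have ax: "near e \<pi> = near l \<pi> \<or> near e \<pi> = near (rot l) \<pi>" if "l \<in> unit_steps" for l
    using unit_cases[OF that assms(2)] by auto
  {
    assume "extends_box \<pi>"
    note s = extends_box_state[OF assms(1) this, folded assms(3)]
    show "near e \<pi> \<le> min (gap (rot l) \<pi>) (gap (- rot l) \<pi>)"
      using ax[OF s(1)] s(2) by (auto simp: near_def)
  }
  {
    assume "\<not> extends_box \<pi>"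
    then obtain f where f: "f \<in> {rot l, - rot l}" "gap f \<pi> = 0" "allowed \<pi> = {l, f}"
      using not_extends_box_state[OF assms(1)] assms(3) by blast
    then have "l \<in> unit_steps" using allowed_unit by blast
    then show "near e \<pi> \<le> min (gap l \<pi>) (gap (- l) \<pi>)"
      using ax[of l] f by (auto simp: near_def)
  }
qed

locale tilted = supersolution +
  fixes e :: "int \<times> int" and a :: real
  assumes e: "e \<in> unit_steps" and U_eq: "U = (\<lambda>b. z * (if b then exp a else 1))"
begin

definition \<Phi> :: "(int \<times> int) list \<Rightarrow> real" where
  "\<Phi> \<pi> = z ^ (length \<pi> - 1) * exp (a * real (width e \<pi>)) * state_val e Ev Lv \<pi>"

lemma Sv_eq: "Sv = lateral_val U z Ev Lv"
  by (intro ext) (simp add: Sv_def lateral_val_def)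

lemma \<Phi>_super:
  assumes \<pi>: "\<pi> \<in> prudent_paths (Suc L)"
  shows "(\<Sum>d\<in>allowed \<pi>. \<Phi> (grow \<pi> d)) \<le> \<Phi> \<pi>"
proof -
  have ne: "\<pi> \<noteq> []" and len: "length \<pi> = Suc (Suc L)"
    using \<pi> by (auto simp: prudent_paths_ne prudent_paths_length)
  let ?c = "z ^ (length \<pi> - 1) * exp (a * real (width e \<pi>))"
  have "\<Phi> (grow \<pi> d) = ?c * (step_weight e U z \<pi> d * state_val e Ev Lv (grow \<pi> d))"
    if "d \<in> allowed \<pi>" for d
  proof -
    have "\<Phi> (grow \<pi> d) = z ^ Suc L * (z * exp (a * real (width e (grow \<pi> d)))) * state_val e Ev Lv (grow \<pi> d)"
      unfolding \<Phi>_def by (simp add: len)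
    also have "\<dots> = ?c * (step_weight e U z \<pi> d * state_val e Ev Lv (grow \<pi> d))"
      unfolding exp_width_grow[OF ne allowed_unit[OF that] e U_eq] by (simp add: len)
    finally show ?thesis .
  qed
  then have "(\<Sum>d\<in>allowed \<pi>. \<Phi> (grow \<pi> d)) =
      ?c * (\<Sum>d\<in>allowed \<pi>. step_weight e U z \<pi> d * state_val e Ev Lv (grow \<pi> d))"
    by (simp add: sum_distrib_left)
  also have "(\<Sum>d\<in>allowed \<pi>. step_weight e U z \<pi> d * state_val e Ev Lv (grow \<pi> d)) \<le> state_val e Ev Lv \<pi>"
    unfolding sum_state_val[OF \<pi> e Ev_commute refl] unfolding Sv_eq[symmetric] state_val_def Let_def
    using Ev_super Lv_super by (auto simp del: not_def)
  then have "?c * (\<Sum>d\<in>allowed \<pi>. step_weight e U z \<pi> d * state_val e Ev Lv (grow \<pi> d)) \<le> ?c * state_val e Ev Lv \<pi>"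
    using z_pos by (intro mult_left_mono) auto
  finally show ?thesis by (simp add: \<Phi>_def)
qed

text \<open>The comparison starts at length 1 because the one-point walk has no last step and hence
  no phase.\<close>

lemma sum_\<Phi>_le: "sum \<Phi> (prudent_paths (Suc L)) \<le> sum \<Phi> (prudent_paths 1)"
proof (induction L)
  case (Suc L)
  have "sum \<Phi> (prudent_paths (Suc (Suc L))) \<le> sum \<Phi> (prudent_paths (Suc L))"
    unfolding sum_prudent_paths_Suc[of \<Phi> "Suc L"] by (intro sum_mono \<Phi>_super)
  with Suc show ?case by simp
qed simp

text \<open>This is the purpose of the \<open>m\<close> terms: the powers of \<rho> decay with the
  distance and could not charge for states far from the corners.\<close>

lemma state_val_ge:
  assumes "\<pi> \<in> prudent_paths (Suc L)" "e' \<in> unit_steps"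
  shows "\<kappa> * min 1 (min (p True) (p False)) * \<beta> ^ near e' \<pi> \<le> state_val e Ev Lv \<pi>"
proof -
  let ?k = "min 1 (min (p True) (p False))"
  let ?l = "last_step \<pi>"
  have k: "0 \<le> ?k" "?k \<le> 1" "\<And>b. ?k \<le> p b" using p_pos[of True] p_pos[of False] by (auto, case_tac b, auto)
  have m: "\<beta> ^ n \<le> m i j" if "n \<le> min i j" for n i j
    using that \<beta>_ge by (auto simp: m_def intro!: power_increasing)
  show ?thesis
  proof (cases "extends_box \<pi>")
    case True
    let ?i = "gap (rot ?l) \<pi>" and ?j = "gap (- rot ?l) \<pi>"
    have "\<kappa> * ?k * \<beta> ^ near e' \<pi> \<le> \<kappa> * 1 * m ?i ?j"
      using near_state(1)[OF assms refl True] k \<kappa>_pos m m_pos[of ?i ?j] \<beta>_ge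
      by (intro mult_mono mult_left_mono) auto
    also have "\<dots> \<le> Ev b A ?i ?j" for b A using Ev_ge by simp
    finally show ?thesis using True by (simp add: state_val_def Let_def)
  next
    case False
    let ?i = "gap ?l \<pi>" and ?j = "gap (- ?l) \<pi>"
    have "\<kappa> * ?k * \<beta> ^ near e' \<pi> \<le> \<kappa> * p b * m ?i ?j" for b
      using near_state(2)[OF assms refl False] k(1,2) k(3)[of b] \<kappa>_pos m m_pos[of ?i ?j] \<beta>_ge p_pos[of b]
      by (intro mult_mono mult_left_mono) auto
    also have "\<kappa> * p b * m ?i ?j \<le> Lv b A ?i ?j" for b A using Lv_ge by simp
    finally show ?thesis using False by (simp add: state_val_def Let_def)
  qed
qed

theorem tilted_sum_bounded:
  "\<exists>C>0. \<forall>L. \<forall>e'\<in>unit_steps. (\<Sum>\<pi>\<in>prudent_paths L. exp (a * real (width e \<pi>)) * \<beta> ^ near e' \<pi>) \<le> C / z ^ L"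
proof -
  let ?k = "\<kappa> * min 1 (min (p True) (p False))"
  have k: "?k > 0" using \<kappa>_pos p_pos by simp
  define C1 where "C1 = sum \<Phi> (prudent_paths 1) / ?k"
  define C where "C = max 1 C1"
  have "(\<Sum>\<pi>\<in>prudent_paths L. exp (a * real (width e \<pi>)) * \<beta> ^ near e' \<pi>) * z ^ L \<le> C"
    if e': "e' \<in> unit_steps" for L e'
  proof (cases L)
    case 0
    then show ?thesis by (simp add: prudent_paths_0 width_def near_def gap_def extent_def C_def)
  next
    case (Suc n)
    have "?k * ((\<Sum>\<pi>\<in>prudent_paths L. exp (a * real (width e \<pi>)) * \<beta> ^ near e' \<pi>) * z ^ L) =
      (\<Sum>\<pi>\<in>prudent_paths L. z ^ (length \<pi> - 1) * exp (a * real (width e \<pi>)) * (?k * \<beta> ^ near e' \<pi>))"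
      unfolding sum_distrib_left sum_distrib_right
      by (intro sum.cong) (auto dest!: prudent_paths_length simp: mult_ac)
    also have "\<dots> \<le> sum \<Phi> (prudent_paths L)"
      unfolding \<Phi>_def using z_pos Suc
      by (intro sum_mono mult_left_mono state_val_ge) (auto intro: e')
    also have "\<dots> \<le> sum \<Phi> (prudent_paths 1)" unfolding Suc by (rule sum_\<Phi>_le)
    finally have "(\<Sum>\<pi>\<in>prudent_paths L. exp (a * real (width e \<pi>)) * \<beta> ^ near e' \<pi>) * z ^ L \<le> C1"
      unfolding C1_def using k by (simp add: le_divide_eq mult.commute)
    then show ?thesis by (simp add: C_def)
  qed
  then show ?thesis using z_pos
    by (intro exI[of _ C]) (auto simp: le_divide_eq C_def)
qed

end

section \<open>The lower bound on the number of walks\<close>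

text \<open>
  Subtracting from the half-plane solution a small constant, which is a strict supersolution, makes
  it vanish at distance at least \<open>K\<close> from the corner. Its positive part is therefore a bounded
  subsolution for walks whose box is at least \<open>K\<close> wide and high.
\<close>

locale subsolution =
  fixes z F :: real
  assumes z_pos: "0 < z" and z_lt1: "z < 1" and F_gt1: "1 < F"
    and \<rho>_lt1: "z * (1 + F) < 1"
    and z_ge: "F * (1 - z\<^sup>2 * (1 + F)) \<le> z * ((1 + F) * (1 - z\<^sup>2))"
    and z_lat: "z * (1 + z) \<le> 1 - z"
begin

definition \<rho> :: real where "\<rho> = z * (1 + F)"
definition q :: real where "q = F / (1 - z * \<rho>)"
text \<open>Makes \<open>F / z - D = 1 / z\<close>, so that after the subtraction the exit at a
  corner still has weight at least 1. The subtracted strict supersolution is \<open>D\<close> after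
  a push and \<open>D * p\<close> after a sideways step.\<close>

definition D :: real where "D = (F - 1) / z"
definition p :: real where "p = z / (1 - z)"
definition eL :: "nat \<Rightarrow> real" where "eL i = max 0 (F / z * \<rho> ^ i - D)"
text \<open>\<open>tL\<close> is the share of the corner which the walk moves towards,
  \<open>wL\<close> that of the corner left behind.\<close>

definition tL :: "nat \<Rightarrow> real" where "tL i = max 0 ((1 + F) * \<rho> ^ i - D * p)"
definition wL :: "nat \<Rightarrow> real" where "wL i = max 0 (q * \<rho> ^ i - D * p)"

lemma \<rho>_pos: "0 < \<rho>" unfolding \<rho>_def using z_pos F_gt1 by simp

lemma z\<rho>: "z * \<rho> < 1"
  using mult_strict_mono[of z 1 "\<rho>" 1] z_lt1 \<rho>_pos \<rho>_lt1 unfolding \<rho>_def by simp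

lemma q_pos: "0 < q" unfolding q_def using z\<rho> F_gt1 by simp

lemma q_eq: "F + z * \<rho> * q = q"
proof -
  have "q * (1 - z * \<rho>) = F" unfolding q_def using z\<rho> by simp
  then show ?thesis by (simp add: algebra_simps)
qed

lemma D_pos: "0 < D" unfolding D_def using F_gt1 z_pos by simp

lemma p_pos: "0 < p" unfolding p_def using z_pos z_lt1 by simp

lemma p_eq: "z + z * p = p"
proof -
  have "p * (1 - z) = z" unfolding p_def using z_lt1 by simp
  then show ?thesis by (simp add: algebra_simps)
qed

lemma p_lat: "z + 2 * (z * p) \<le> 1"
proof -
  have "z + 2 * (z * p) = z * (1 + z) / (1 - z)"
    unfolding p_def using z_lt1 by (simp add: field_simps)
  also have "\<dots> \<le> 1" using z_lat z_lt1 by simp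
  finally show ?thesis .
qed

lemma F_div_z: "F / z \<le> 1 + q"
proof -
  have d: "1 - z\<^sup>2 * (1 + F) > 0" using z\<rho> by (simp add: \<rho>_def power2_eq_square mult.assoc)
  have "F / z \<le> (1 + F) * (1 - z\<^sup>2) / (1 - z\<^sup>2 * (1 + F))"
    using z_ge d z_pos by (simp add: divide_le_eq le_divide_eq mult.commute mult.left_commute)
  also have "\<dots> = 1 + F / (1 - z\<^sup>2 * (1 + F))"
    using d by (simp add: field_simps)
  also have "\<dots> = 1 + q" by (simp add: q_def \<rho>_def power2_eq_square mult.assoc)
  finally show ?thesis .
qed

lemma nonneg [simp]: "0 \<le> eL i" "0 \<le> tL i" "0 \<le> wL i"
  by (auto simp: eL_def tL_def wL_def)

lemma eL_0: "z * eL 0 \<ge> 1" "eL 0 > 0"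
proof -
  have "F / z - D = 1 / z" unfolding D_def using z_pos by (simp add: field_simps)
  then show "z * eL 0 \<ge> 1" "eL 0 > 0" using z_pos by (auto simp: eL_def)
qed

lemma tL_0: "tL 0 \<le> z * eL 0 + 1"
proof -
  have "z * eL 0 \<ge> 1" by (rule eL_0)
  have "z * (F / z * \<rho> ^ 0 - D) \<le> z * eL 0" unfolding eL_def using z_pos by (intro mult_left_mono) auto
  moreover have "z * (F / z * \<rho> ^ 0 - D) = F - z * D" using z_pos by (simp add: algebra_simps)
  moreover have "z * D \<le> p * D" using p_eq mult_pos_pos[OF z_pos p_pos] D_pos by (intro mult_right_mono) linarith+
  ultimately show ?thesis using \<open>z * eL 0 \<ge> 1\<close> by (auto simp: tL_def mult.commute)
qed

lemma z_eL_ge: "F * \<rho> ^ i - z * D \<le> z * eL i"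
proof -
  have "z * (F / z * \<rho> ^ i - D) \<le> z * eL i" unfolding eL_def using z_pos by (intro mult_left_mono) auto
  then show ?thesis using z_pos by (simp add: algebra_simps)
qed

lemma z_tL_ge: "\<rho> ^ Suc i - z * p * D \<le> z * tL i"
proof -
  have "z * ((1 + F) * \<rho> ^ i - D * p) \<le> z * tL i" unfolding tL_def using z_pos by (intro mult_left_mono) auto
  then show ?thesis by (simp add: \<rho>_def algebra_simps)
qed

lemma z_wL_ge: "z * q * \<rho> ^ Suc i - z * p * D \<le> z * wL (Suc i)"
proof -
  have "z * (q * \<rho> ^ Suc i - D * p) \<le> z * wL (Suc i)" unfolding wL_def using z_pos by (intro mult_left_mono) auto
  then show ?thesis by (simp add: algebra_simps)
qed

lemma pD: "p * D = z * D + z * p * D"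
  using p_eq by (metis distrib_right)

lemma tL_Suc: "tL (Suc i) \<le> z * eL (Suc i) + z * tL i"
proof -
  have "0 \<le> z * eL (Suc i) + z * tL i" using z_pos by simp
  moreover have "(1 + F) * \<rho> ^ Suc i = \<rho> ^ Suc i + F * \<rho> ^ Suc i" by (simp add: distrib_right del: power_Suc)
  ultimately show ?thesis
    using z_eL_ge[of "Suc i"] z_tL_ge[of i] pD mult.commute[of D p] unfolding tL_def[of "Suc i"]
    by (intro max.boundedI; linarith)
qed

lemma wL_le: "wL i \<le> z * eL i + z * wL (Suc i)"
proof -
  have "0 \<le> z * eL i + z * wL (Suc i)" using z_pos by simp
  moreover have "q * \<rho> ^ i = F * \<rho> ^ i + z * q * \<rho> ^ Suc i"
    using arg_cong[OF q_eq, of "\<lambda>t. t * \<rho> ^ i"] by (simp add: algebra_simps)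
  ultimately show ?thesis
    using z_eL_ge[of i] z_wL_ge[of i] pD mult.commute[of D p] unfolding wL_def[of i]
    by (intro max.boundedI; linarith)
qed

lemma eL_le:
  assumes "0 \<le> y" "\<rho> ^ i - z * p * D \<le> y"
  shows "eL i \<le> z * eL i + y + z * wL (Suc i)"
proof -
  have "0 \<le> z * eL i + y + z * wL (Suc i)" using z_pos assms(1) by simp
  moreover have "F / z * \<rho> ^ i \<le> \<rho> ^ i + F * \<rho> ^ i + z * q * \<rho> ^ Suc i"
  proof -
    have "F / z * \<rho> ^ i \<le> (1 + q) * \<rho> ^ i" using F_div_z \<rho>_pos by (intro mult_right_mono) auto
    also have "(1 + q) * \<rho> ^ i = \<rho> ^ i + F * \<rho> ^ i + z * q * \<rho> ^ Suc i"
      using arg_cong[OF q_eq, of "\<lambda>t. t * \<rho> ^ i"] by (simp add: algebra_simps)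
    finally show ?thesis .
  qed
  moreover have "z * D + 2 * (z * p * D) \<le> D"
    using mult_right_mono[OF p_lat, of D] D_pos by (simp add: algebra_simps)
  ultimately show ?thesis
    using z_eL_ge[of i] z_wL_ge[of i] assms(2) unfolding eL_def[of i]
    by (intro max.boundedI; linarith)
qed

lemma vanish: "\<exists>K. \<forall>i\<ge>K. eL i = 0 \<and> tL i = 0 \<and> wL i = 0"
proof -
  have *: "\<forall>\<^sub>F i in sequentially. max 0 (c * \<rho> ^ i - d) = 0" if "0 < d" for c d :: real
  proof -
    have "(\<lambda>i. c * \<rho> ^ i) \<longlonglongrightarrow> c * 0"
      using \<rho>_pos \<rho>_lt1 by (intro tendsto_mult tendsto_const LIMSEQ_realpow_zero) (auto simp: \<rho>_def)
    then have "\<forall>\<^sub>F i in sequentially. c * \<rho> ^ i < d" using that by (auto dest: order_tendstoD)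
    then show ?thesis by eventually_elim auto
  qed
  have "\<forall>\<^sub>F i in sequentially. eL i = 0 \<and> tL i = 0 \<and> wL i = 0"
    unfolding eL_def tL_def wL_def using D_pos p_pos by (intro eventually_conj *) auto
  then show ?thesis by (simp add: eventually_sequentially)
qed

definition K :: nat where "K = (SOME K. \<forall>i\<ge>K. eL i = 0 \<and> tL i = 0 \<and> wL i = 0)"

lemma K: "K \<le> i \<Longrightarrow> eL i = 0 \<and> tL i = 0 \<and> wL i = 0"
  using someI_ex[OF vanish] unfolding K_def by blast

text \<open>In a box below size \<open>K\<close> the value is zero and the inequality holds by
  nonnegativity; above it, a walk at one corner gets nothing from the opposite one.\<close>

definition El :: "bool \<Rightarrow> nat \<Rightarrow> nat \<Rightarrow> nat \<Rightarrow> real" where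
  "El b A i j = (if K \<le> A \<and> K \<le> i + j then eL i + eL j else 0)"

definition Ll :: "bool \<Rightarrow> nat \<Rightarrow> nat \<Rightarrow> nat \<Rightarrow> real" where
  "Ll b A i j = (if K \<le> A \<and> K \<le> i + j then tL i + wL j else 0)"

abbreviation Sl :: "bool \<Rightarrow> nat \<Rightarrow> nat \<Rightarrow> nat \<Rightarrow> real" where
  "Sl \<equiv> lateral_val (\<lambda>_. z) z El Ll"

lemma El_nonneg: "0 \<le> El b A i j" and Ll_nonneg: "0 \<le> Ll b A i j" and Sl_nonneg: "0 \<le> Sl b A i j"
  using z_pos by (auto simp: El_def Ll_def lateral_val_def)

text \<open>At \<open>i = 0\<close> the exit supplies the boundary value 1 through
  \<open>eL_0\<close>. The \<open>wL\<close> term then missing does no harm, since \<open>j\<close>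
  is at least \<open>K\<close>.\<close>

lemma Sl_ge:
  assumes "K \<le> A" "K \<le> i + j"
  shows "Sl b A i j \<ge> (if i = 0 then 1 else z * tL (i - 1)) + (if i = 0 then 0 else z * wL (Suc j))"
proof (cases "i = 0")
  case True
  have "1 \<le> z * eL 0" by (rule eL_0)
  also have "\<dots> \<le> z * eL 0 + z * eL A" using z_pos by simp
  finally show ?thesis using True assms by (simp add: lateral_val_def El_def algebra_simps)
next
  case False
  then have "K \<le> (i - 1) + Suc j" using assms by simp
  then show ?thesis using False assms by (simp add: lateral_val_def Ll_def algebra_simps)
qed

lemma Ll_sub: "Ll b A i j \<le> z * El b (Suc A) i j + Sl b A i j"
proof (cases "K \<le> A \<and> K \<le> i + j")
  case True
  have "tL i \<le> z * eL i + (if i = 0 then 1 else z * tL (i - 1))"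
    using tL_0 tL_Suc[of "i - 1"] by (cases i) auto
  moreover have "wL j \<le> z * eL j + (if i = 0 then 0 else z * wL (Suc j))"
    using wL_le[of j] K[of j] True z_pos by auto
  ultimately show ?thesis
    using Sl_ge[of A i j b] True by (simp add: Ll_def El_def algebra_simps)
next
  case False
  then show ?thesis using El_nonneg[of b "Suc A" i j] Sl_nonneg[of b A i j] z_pos by (auto simp: Ll_def)
qed

lemma El_sub: "El b A i j \<le> z * El b (Suc A) i j + Sl b A i j + Sl b A j i"
proof (cases "K \<le> A \<and> K \<le> i + j")
  case True
  \<comment> \<open>At \<open>j = 0\<close> the step towards the other corner changes the phase and
    yields no \<open>wL\<close>, but then \<open>i\<close> is at least \<open>K\<close> and
    \<open>eL i\<close> vanishes.\<close>
  have e: "eL i \<le> z * eL i + (if i = 0 then 1 else z * tL (i - 1)) + (if j = 0 then 0 else z * wL (Suc i))"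
    if "K \<le> i + j" for i j
  proof (cases "j = 0")
    case True
    then show ?thesis using K[of i] that z_pos by auto
  next
    case False
    have "0 < z * p * D" using z_pos p_pos D_pos by simp
    then have "eL i \<le> z * eL i + (if i = 0 then 1 else z * tL (i - 1)) + z * wL (Suc i)"
      using z_tL_ge[of "i - 1"] z_pos by (intro eL_le) (cases i; auto)+
    then show ?thesis using False by simp
  qed
  show ?thesis
    using e[of i j] e[of j i] Sl_ge[of A i j b] Sl_ge[of A j i b] True
    by (simp add: El_def algebra_simps)
next
  case False
  then show ?thesis
    using El_nonneg[of b "Suc A" i j] Sl_nonneg[of b A i j] Sl_nonneg[of b A j i] z_pos by (auto simp: El_def)
qed

lemma El_commute: "El b A i j = El b A j i"
  by (simp add: El_def add.commute)

abbreviation val :: "(int \<times> int) list \<Rightarrow> real" where "val \<equiv> state_val (1, 0) El Ll"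

lemma val_bounded: "val \<pi> \<le> 2 * (F / z) + (1 + F) + q"
proof -
  have pw: "c * \<rho> ^ i \<le> c" if "0 \<le> c" for c i
    using that \<rho>_pos \<rho>_lt1 power_le_one[of \<rho> i] mult_left_le[of "\<rho> ^ i" c] by (simp add: \<rho>_def)
  have "0 \<le> F / z" using F_gt1 z_pos by simp
  have "eL i \<le> F / z" "tL i \<le> 1 + F" "wL i \<le> q" for i
    unfolding eL_def tL_def wL_def
    using pw[of "F / z" i] pw[of "1 + F" i] pw[of q i] D_pos mult_pos_pos[OF D_pos p_pos] q_pos F_gt1 \<open>0 \<le> F / z\<close>
    by (intro max.boundedI; linarith)+
  from this(1)[of "gap (rot (last_step \<pi>)) \<pi>"] this(1)[of "gap (- rot (last_step \<pi>)) \<pi>"]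
    this(2)[of "gap (last_step \<pi>) \<pi>"] this(3)[of "gap (- last_step \<pi>) \<pi>"]
  show ?thesis using \<open>0 \<le> F / z\<close> F_gt1 q_pos
    by (simp add: state_val_def El_def Ll_def Let_def)
qed

lemma sum_val_mono:
  "z ^ Suc L * sum val (prudent_paths (Suc L)) \<le> z ^ Suc (Suc L) * sum val (prudent_paths (Suc (Suc L)))"
proof -
  have "val \<pi> \<le> (\<Sum>d\<in>allowed \<pi>. z * val (grow \<pi> d))" if "\<pi> \<in> prudent_paths (Suc L)" for \<pi>
  proof -
    have "(\<Sum>d\<in>allowed \<pi>. z * val (grow \<pi> d)) =
        (\<Sum>d\<in>allowed \<pi>. step_weight (1, 0) (\<lambda>_. z) z \<pi> d * val (grow \<pi> d))"
      by (simp add: step_weight_def)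
    also have "\<dots> \<ge> val \<pi>"
      by (subst sum_state_val[OF that _ El_commute refl])
        (auto simp: unit_steps_def state_val_def Let_def intro: El_sub Ll_sub simp del: not_def)
    finally show ?thesis .
  qed
  then have "sum val (prudent_paths (Suc L)) \<le> z * sum val (prudent_paths (Suc (Suc L)))"
    unfolding sum_prudent_paths_Suc[of val "Suc L"] by (simp add: sum_distrib_left sum_mono)
  then show ?thesis using z_pos by simp
qed

end

section \<open>Walks with a large box, on which the subsolution is positive\<close>

lemma straight_path:
  "\<exists>\<pi>\<in>prudent_paths (Suc n). extends_box \<pi> \<and> last_step \<pi> = (1, 0) \<and> width (1, 0) \<pi> = Suc n \<and>
     gap (0, 1) \<pi> = 0 \<and> gap (0, -1) \<pi> = 0"
proof (induction n)
  case 0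
  have "gap f [(0, 0)] = 0" for f by (simp add: gap_def extent_def)
  moreover have "(1, 0) \<in> unit_steps" by (simp add: unit_steps_def)
  moreover have "grow [(0, 0)] (1, 0) \<in> prudent_paths (Suc 0)"
    by (subst prudent_paths_snoc)
      (use calculation allowed_if_gap0[of "[(0, 0)]" "(1, 0)"] in \<open>simp add: prudent_paths_0\<close>)
  ultimately show ?case
    using gap_grow_simps[of "[(0,0)]" "(1,0)"] width_grow[of "[(0,0)]" "(1,0)"]
    by (intro bexI[of _ "grow [(0, 0)] (1, 0)"] conjI extends_box_grow[THEN iffD2] last_step_grow)
      (simp_all add: prudent_paths_snoc prudent_paths_0 rot_def width_def)
next
  case (Suc n)
  then obtain \<pi> where \<pi>: "\<pi> \<in> prudent_paths (Suc n)" "extends_box \<pi>" "last_step \<pi> = (1, 0)" "width (1, 0) \<pi> = Suc n"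
     "gap (0, 1) \<pi> = 0" "gap (0, -1) \<pi> = 0" by blast
  have ne: "\<pi> \<noteq> []" using \<pi>(1) by (rule prudent_paths_ne)
  note s = extends_box_state[OF \<pi>(1,2)]
  show ?case
    using s \<pi> ne gap_grow_simps[OF ne s(1)] width_grow[OF ne s(1)]
    by (intro bexI[of _ "grow \<pi> (1, 0)"] conjI extends_box_grow[THEN iffD2] last_step_grow)
      (simp_all add: prudent_paths_snoc rot_def)
qed

text \<open>First right, then up, ending at a corner. With \<open>m\<close> and \<open>n\<close>
  equal to \<open>K\<close> both widths exceed the cut-off and \<open>eL 0\<close> makes the value
  positive.\<close>

lemma corner_path:
  "\<exists>\<pi>\<in>prudent_paths (Suc (Suc n + m)). extends_box \<pi> \<and> last_step \<pi> = (0, 1) \<and> width (0, 1) \<pi> = Suc m \<and>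
     gap (-1, 0) \<pi> = Suc n \<and> gap (1, 0) \<pi> = 0"
proof (induction m)
  case 0
  obtain \<pi> where \<pi>: "\<pi> \<in> prudent_paths (Suc n)" "extends_box \<pi>" "last_step \<pi> = (1, 0)" "width (1, 0) \<pi> = Suc n"
     "gap (0, 1) \<pi> = 0" "gap (0, -1) \<pi> = 0" using straight_path by blast
  have ne: "\<pi> \<noteq> []" using \<pi>(1) by (rule prudent_paths_ne)
  note s = extends_box_state[OF \<pi>(1,2)]
  have u: "(0, 1) \<in> unit_steps" by (simp add: unit_steps_def)
  show ?case
    using s \<pi> ne gap_grow_simps[OF ne u] width_grow[OF ne u]
    by (intro bexI[of _ "grow \<pi> (0, 1)"] conjI extends_box_grow[THEN iffD2] last_step_grow)
      (simp_all add: prudent_paths_snoc rot_def width_def)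
next
  case (Suc m)
  then obtain \<pi> where \<pi>: "\<pi> \<in> prudent_paths (Suc (Suc n + m))" "extends_box \<pi>" "last_step \<pi> = (0, 1)" "width (0, 1) \<pi> = Suc m"
     "gap (-1, 0) \<pi> = Suc n" "gap (1, 0) \<pi> = 0" by blast
  have ne: "\<pi> \<noteq> []" using \<pi>(1) by (rule prudent_paths_ne)
  note s = extends_box_state[OF \<pi>(1,2)]
  show ?case
    using s \<pi> ne gap_grow_simps[OF ne s(1)] width_grow[OF ne s(1)]
    by (intro bexI[of _ "grow \<pi> (0, 1)"] conjI extends_box_grow[THEN iffD2] last_step_grow)
      (simp_all add: prudent_paths_snoc rot_def)
qed

context subsolution
begin

text \<open>The weighted sum of \<open>val\<close> increases from a length at which it is positive;
  since \<open>val\<close> is bounded, the number of walks must carry that growth.\<close>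

theorem card_prudent_paths_ge:
  "\<exists>C>0. \<exists>L0. \<forall>L\<ge>L0. C / z ^ L \<le> real (card (prudent_paths L))"
proof -
  obtain n where n: "\<exists>\<pi>\<in>prudent_paths (Suc n). 0 < val \<pi>"
  proof -
    obtain \<pi> where \<pi>: "\<pi> \<in> prudent_paths (Suc (Suc K + K))" "extends_box \<pi>" "last_step \<pi> = (0, 1)" "width (0, 1) \<pi> = Suc K"
     "gap (-1, 0) \<pi> = Suc K" "gap (1, 0) \<pi> = 0" using corner_path by blast
    have "0 < val \<pi>"
      using \<pi> eL_0 by (simp add: state_val_def El_def Let_def rot_def add_nonneg_pos)
    then show ?thesis using that \<pi>(1) by blast
  qed
  define M where "M = 2 * (F / z) + (1 + F) + q"
  have M: "0 < M" unfolding M_def using F_gt1 z_pos q_pos by (simp add: add_pos_pos)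
  define S where "S L = z ^ Suc L * sum val (prudent_paths (Suc L))" for L
  have val_nonneg: "0 \<le> val \<pi>" for \<pi>
    using El_nonneg Ll_nonneg by (simp add: state_val_def Let_def)
  have "0 < S n"
  proof -
    from n obtain \<pi> where "\<pi>\<in>prudent_paths (Suc n)" "0 < val \<pi>" by blast
    then have "0 < sum val (prudent_paths (Suc n))"
      using val_nonneg by (intro sum_pos2[of _ \<pi>]) (auto simp: finite_prudent_paths)
    then show ?thesis using z_pos by (simp add: S_def)
  qed
  have inc: "incseq S" unfolding S_def using sum_val_mono by (intro incseq_SucI)
  have "S n / M / z ^ L \<le> real (card (prudent_paths L))" if "L \<ge> Suc n" for L
  proof -
    define k where "k = L - 1"
    have L: "L = Suc k" "n \<le> k" using that by (auto simp: k_def)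
    have "S n \<le> S k" using inc L(2) by (simp add: incseqD)
    also have "\<dots> \<le> z ^ L * (real (card (prudent_paths L)) * M)"
      unfolding S_def L(1) using val_bounded z_pos
      by (intro mult_left_mono sum_bounded_above) (auto simp: M_def)
    finally show ?thesis using M z_pos by (simp add: divide_le_eq mult_ac)
  qed
  then show ?thesis using \<open>0 < S n\<close> M by (intro exI[of _ "S n / M"]) auto
qed

end

section \<open>The critical weight and the speed\<close>

text \<open>
  \<open>\<sigma>\<close> is the inverse of the growth rate of the number of walks. Without tilt criticality means
  \<open>F = 1\<close>, hence \<open>\<rho> = 2 \<sigma>\<close>, and \<open>U = \<sigma>\<close> becomes the cubic equation.
\<close>

definition \<sigma> :: real where
  "\<sigma> = (SOME s. 2 / 5 < s \<and> s < 41 / 100 \<and> 2 * s ^ 3 - 2 * s\<^sup>2 - 2 * s + 1 = 0)"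

lemma \<sigma>: "2 / 5 < \<sigma>" "\<sigma> < 41 / 100" "1 - 2 * \<sigma>\<^sup>2 = 2 * \<sigma> * (1 - \<sigma>\<^sup>2)"
proof -
  let ?f = "\<lambda>s::real. 2 * s ^ 3 - 2 * s\<^sup>2 - 2 * s + 1"
  have "\<exists>s\<ge>2/5. s \<le> 41/100 \<and> ?f s = 0"
    by (intro IVT2' continuous_intros) (auto simp: power2_eq_square power3_eq_cube)
  then obtain s where s: "2/5 \<le> s" "s \<le> 41/100" "?f s = 0" by blast
  have "?f (2/5) \<noteq> 0" "?f (41/100) \<noteq> 0" by (auto simp: power2_eq_square power3_eq_cube)
  with s have "s \<noteq> 2/5" "s \<noteq> 41/100" by metis+
  with s have "\<exists>s. 2 / 5 < s \<and> s < 41 / 100 \<and> ?f s = 0" by (intro exI[of _ s]) auto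
  from someI_ex[OF this]
  show "2 / 5 < \<sigma>" "\<sigma> < 41 / 100" "1 - 2 * \<sigma>\<^sup>2 = 2 * \<sigma> * (1 - \<sigma>\<^sup>2)"
    unfolding \<sigma>_def[symmetric] by (auto simp: power2_eq_square power3_eq_cube algebra_simps)
qed

lemma \<sigma>_pos: "0 < \<sigma>" using \<sigma> by simp

lemma \<sigma>_sq: "\<sigma>\<^sup>2 < 17 / 100"
proof -
  have "\<sigma>\<^sup>2 < (41 / 100)\<^sup>2" using \<sigma> by (intro power_strict_mono) auto
  then show ?thesis by (simp add: power2_eq_square)
qed

text \<open>\<open>qF\<close> and \<open>qz\<close> are the derivatives at the critical point of
  \<open>ln (F (1 - z\<^sup>2 (1 + F)) / ((1 + F) (1 - z\<^sup>2) z))\<close> with respect to \<open>F\<close> and to \<open>- ln z\<close>.\<close>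

definition qF :: real where "qF = 1 / 2 - \<sigma>\<^sup>2 / (1 - 2 * \<sigma>\<^sup>2)"
definition qz :: real where "qz = 1 + 4 * \<sigma>\<^sup>2 / (1 - 2 * \<sigma>\<^sup>2) - 2 * \<sigma>\<^sup>2 / (1 - \<sigma>\<^sup>2)"

lemma qF_pos: "0 < qF"
  unfolding qF_def using \<sigma>_sq by (simp add: divide_less_eq)

lemma qz_pos: "0 < qz"
proof -
  have "2 * \<sigma>\<^sup>2 / (1 - \<sigma>\<^sup>2) < 1" using \<sigma>_sq by (simp add: divide_less_eq)
  moreover have "0 \<le> 4 * \<sigma>\<^sup>2 / (1 - 2 * \<sigma>\<^sup>2)" using \<sigma>_sq by simp
  ultimately show ?thesis unfolding qz_def by linarith
qed

text \<open>
  To first order in a tilt \<open>a\<close> of one axis, the constraints \<open>U = z exp a\<close> and \<open>U = z\<close> for the two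
  kinds of phases together with \<open>F True * F False = 1\<close> force \<open>a = - 2 qz ln (z / \<sigma>)\<close>.
\<close>

definition speed :: real where "speed = 1 / (2 * qz)"

lemma speed_pos: "0 < speed" unfolding speed_def using qz_pos by simp

text \<open>The logarithm of the ratio of the right to the left side of \<open>U_le\<close> for
  \<open>U = z\<close>, along the curve \<open>F = exp (\<phi> s)\<close>, \<open>z = \<sigma> exp (- k s)\<close>.\<close>

definition Q :: "real \<Rightarrow> real \<Rightarrow> real \<Rightarrow> real" where
  "Q \<phi> k s = \<phi> * s + ln (1 - \<sigma>\<^sup>2 * exp (- (2 * k * s)) * (1 + exp (\<phi> * s))) - ln (1 + exp (\<phi> * s))
     - ln (1 - \<sigma>\<^sup>2 * exp (- (2 * k * s))) - ln \<sigma> + k * s"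

lemma Q_0: "Q \<phi> k 0 = 0"
proof -
  have "ln (1 - \<sigma>\<^sup>2 * 2) = ln (2 * \<sigma> * (1 - \<sigma>\<^sup>2))" using \<sigma>(3) by (simp add: mult.commute)
  also have "\<dots> = ln 2 + ln \<sigma> + ln (1 - \<sigma>\<^sup>2)"
    using \<sigma>_pos \<sigma>_sq by (simp add: ln_mult_pos)
  finally show ?thesis by (simp add: Q_def)
qed

lemma Q_deriv: "(Q \<phi> k has_real_derivative (\<phi> * qF + k * qz)) (at 0)"
proof -
  define u where "u = 1 - 2 * \<sigma>\<^sup>2"
  define v where "v = 1 - \<sigma>\<^sup>2"
  have pos: "0 < u" "0 < v" using \<sigma>_sq by (auto simp: u_def v_def)
  have lnD: "((\<lambda>s. ln (f s)) has_real_derivative (d / f 0)) (at 0)"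
    if "(f has_real_derivative d) (at 0)" "0 < f 0" for f :: "real \<Rightarrow> real" and d
    using DERIV_chain2[OF DERIV_ln_divide[OF that(2)] that(1)] by simp
  have "((\<lambda>s. 1 - \<sigma>\<^sup>2 * exp (- (2 * k * s)) * (1 + exp (\<phi> * s))) has_real_derivative (4 * k * \<sigma>\<^sup>2 - \<phi> * \<sigma>\<^sup>2)) (at 0)"
    by (auto intro!: derivative_eq_intros simp: algebra_simps)
  from lnD[OF this] pos
  have d1: "((\<lambda>s. ln (1 - \<sigma>\<^sup>2 * exp (- (2 * k * s)) * (1 + exp (\<phi> * s)))) has_real_derivative ((4 * k * \<sigma>\<^sup>2 - \<phi> * \<sigma>\<^sup>2) / u)) (at 0)"
    by (simp add: u_def mult.commute)
  have "((\<lambda>s. 1 + exp (\<phi> * s)) has_real_derivative \<phi>) (at 0)"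
    by (auto intro!: derivative_eq_intros)
  from lnD[OF this] have d2: "((\<lambda>s. ln (1 + exp (\<phi> * s))) has_real_derivative (\<phi> / 2)) (at 0)"
    by simp
  have "((\<lambda>s. 1 - \<sigma>\<^sup>2 * exp (- (2 * k * s))) has_real_derivative (2 * k * \<sigma>\<^sup>2)) (at 0)"
    by (auto intro!: derivative_eq_intros)
  from lnD[OF this] pos
  have d3: "((\<lambda>s. ln (1 - \<sigma>\<^sup>2 * exp (- (2 * k * s)))) has_real_derivative (2 * k * \<sigma>\<^sup>2 / v)) (at 0)"
    by (simp add: v_def)
  have lin: "((\<lambda>s. c * s) has_real_derivative c) (at 0)" for c :: real
    by (auto intro!: derivative_eq_intros)
  have "(Q \<phi> k has_real_derivative
      \<phi> + (4 * k * \<sigma>\<^sup>2 - \<phi> * \<sigma>\<^sup>2) / u - \<phi> / 2 - 2 * k * \<sigma>\<^sup>2 / v - 0 + k) (at 0)"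
    unfolding Q_def[abs_def] by (intro DERIV_add DERIV_diff DERIV_const lin d1 d2 d3)
  moreover have "\<phi> + (4 * k * \<sigma>\<^sup>2 - \<phi> * \<sigma>\<^sup>2) / u - \<phi> / 2 - 2 * k * \<sigma>\<^sup>2 / v - 0 + k = \<phi> * qF + k * qz"
    unfolding qF_def qz_def u_def[symmetric] v_def[symmetric]
    by (simp add: diff_divide_distrib right_diff_distrib distrib_left mult_ac)
  ultimately show ?thesis by simp
qed

lemma Q_gt:
  assumes "\<alpha> < \<phi> * qF + k * qz"
  shows "\<forall>\<^sub>F s in at_right 0. \<alpha> * s < Q \<phi> k s"
proof -
  have "((\<lambda>s. Q \<phi> k s - \<alpha> * s) has_real_derivative (\<phi> * qF + k * qz - \<alpha>)) (at 0)"
    by (auto intro!: derivative_eq_intros Q_deriv)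
  from DERIV_pos_inc_right[OF this] assms obtain d where
    "d > 0" "\<And>h. h > 0 \<Longrightarrow> h < d \<Longrightarrow> Q \<phi> k h - \<alpha> * h > 0"
    by (auto simp: Q_0)
  then show ?thesis unfolding eventually_at_right_field by (intro exI[of _ d]) force
qed

lemma Q_lt:
  assumes "\<phi> * qF + k * qz < 0"
  shows "\<forall>\<^sub>F s in at_right 0. Q \<phi> k s < 0"
proof -
  from DERIV_neg_dec_right[OF Q_deriv assms] obtain d where
    "d > 0" "\<And>h. h > 0 \<Longrightarrow> h < d \<Longrightarrow> Q \<phi> k h < 0"
    by (auto simp: Q_0)
  then show ?thesis unfolding eventually_at_right_field by (intro exI[of _ d]) force
qed

text \<open>At \<open>s = 0\<close> the quantities are \<sigma> and \<open>2 * \<sigma>\<close>,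
  strictly inside the bounds. The value 41/100 lies just below \<open>sqrt 2 - 1\<close>, where
  \<open>z * (1 + z) = 1 - z\<close>.\<close>

lemma params_small: "\<forall>\<^sub>F s in at_right 0. \<sigma> * exp (- (k * s)) * exp (\<alpha> * s) < 41 / 100 \<and>
  \<sigma> * exp (- (k * s)) * (1 + exp (\<phi> * s)) < 9 / 10"
proof -
  have 1: "((\<lambda>s. \<sigma> * exp (- (k * s)) * exp (\<alpha> * s)) \<longlongrightarrow> \<sigma> * exp (- (k * 0)) * exp (\<alpha> * 0)) (at_right 0)"
    by (intro tendsto_intros)
  have 2: "((\<lambda>s. \<sigma> * exp (- (k * s)) * (1 + exp (\<phi> * s))) \<longlongrightarrow> \<sigma> * exp (- (k * 0)) * (1 + exp (\<phi> * 0))) (at_right 0)"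
    by (intro tendsto_intros)
  show ?thesis
    using \<sigma> by (intro eventually_conj order_tendstoD(2)[OF 1] order_tendstoD(2)[OF 2]) auto
qed

lemma Q_eq:
  assumes "z = \<sigma> * exp (- (k * s))" "F = exp (\<phi> * s)" "z < 41 / 100" "z * (1 + F) < 9 / 10"
  shows "exp (Q \<phi> k s) * (z * ((1 + F) * (1 - z\<^sup>2))) = F * (1 - z\<^sup>2 * (1 + F))"
proof -
  have z: "0 < z" using assms(1) \<sigma>_pos by simp
  have zz: "z\<^sup>2 = \<sigma>\<^sup>2 * exp (- (2 * k * s))"
    unfolding assms(1) by (simp add: power_mult_distrib flip: exp_of_nat_mult)
  have "z * z < 1 * 1" using z assms(3) by (intro mult_strict_mono) auto
  then have a: "0 < 1 - z\<^sup>2" by (simp add: power2_eq_square)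
  have "z * (z * (1 + F)) < 1 * 1" using z assms by (intro mult_strict_mono) auto
  then have b: "0 < 1 - z\<^sup>2 * (1 + F)" by (simp add: power2_eq_square mult.assoc)
  have c: "0 < F" using assms by simp
  have "Q \<phi> k s = ln F + ln (1 - z\<^sup>2 * (1 + F)) - ln (1 + F) - ln (1 - z\<^sup>2) - ln z"
    unfolding Q_def zz[symmetric] assms(2)[symmetric] using \<sigma>_pos
    by (simp add: assms(1,2) ln_mult_pos)
  then have "exp (Q \<phi> k s) = F * (1 - z\<^sup>2 * (1 + F)) / (1 + F) / (1 - z\<^sup>2) / z"
    using a b c z by (simp add: exp_add exp_diff)
  then show ?thesis using a b c z by simp
qed

text \<open>Any value slightly above \<open>1\<close> keeps \<open>U_lat\<close> valid for weights below \<open>41 / 100\<close>.\<close>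

definition \<beta>0 :: real where "\<beta>0 = 101 / 100"

theorem tilted_bound:
  assumes sg: "sg \<in> {1, -1}" and \<eta>: "0 < \<eta>" and e: "e \<in> unit_steps"
  shows "\<forall>\<^sub>F s in at_right 0. \<exists>C>0. \<forall>L. \<forall>e'\<in>unit_steps.
    (\<Sum>\<pi>\<in>prudent_paths L. exp (sg * s * real (width e \<pi>)) * \<beta>0 ^ near e' \<pi>)
      \<le> C / \<sigma> ^ L * exp ((speed * sg + \<eta>) * s * real L)"
proof -
  \<comment> \<open>The drift is shared equally: \<open>\<phi> * qF = sg / 2\<close> for the tilted
    phase and its opposite for the other. Half of the slack \<open>qz * \<eta>\<close> of the latter
    buys \<iota>, which pushes the product \<open>F1 * F2\<close> below 1.\<close>
  define \<iota> where "\<iota> = qz * \<eta> / (2 * qF)"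
  define k where "k = speed * sg + \<eta>"
  define \<phi> where "\<phi> = sg / (2 * qF)"
  have \<iota>: "0 < \<iota>" unfolding \<iota>_def using qz_pos qF_pos \<eta> by simp
  have "\<phi> * qF + k * qz = sg + qz * \<eta>"
    unfolding \<phi>_def k_def speed_def using qF_pos qz_pos by (simp add: field_simps)
  then have 1: "sg < \<phi> * qF + k * qz" using qz_pos \<eta> by simp
  have eq2: "- (\<phi> + \<iota>) * qF + k * qz = qz * \<eta> / 2"
    unfolding \<phi>_def \<iota>_def k_def speed_def using qF_pos qz_pos by (simp add: field_simps)
  have 2: "0 < - (\<phi> + \<iota>) * qF + k * qz" unfolding eq2 using qz_pos \<eta> by simp
  have "\<forall>\<^sub>F s in at_right (0::real). 0 < s" by (simp add: eventually_at_right_less)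
  then show ?thesis
    using Q_gt[OF 1] Q_gt[OF 2] params_small[of k sg \<phi>] params_small[of k 0 "- (\<phi> + \<iota>)"]
  proof eventually_elim
    case (elim s)
    define z where "z = \<sigma> * exp (- (k * s))"
    define U where "U = (\<lambda>b. z * (if b then exp (sg * s) else 1))"
    define F1 where "F1 = exp (\<phi> * s)"
    define F2 where "F2 = exp (- (\<phi> + \<iota>) * s)"
    define F where "F = (\<lambda>b. if b then F1 else F2)"
    \<comment> \<open>Solves \<open>F1 * (F2 + \<kappa>) + \<kappa> = 1\<close>; as both weights
      \<open>U\<close> are below 1, this gives \<open>X_exit\<close> around the whole cycle of two
      phases.\<close>
    define \<kappa> where "\<kappa> = (1 - F1 * F2) / (F1 + 1)"
    define X where "X = (\<lambda>b. if b then F2 + \<kappa> else 1)"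
    have z: "0 < z" "z < 41 / 100" using elim \<sigma>_pos by (auto simp: z_def)
    have F: "0 < F1" "0 < F2" by (auto simp: F1_def F2_def)
    have U: "0 < U b" "U b < 41 / 100" for b
      using elim z by (cases b; auto simp: U_def z_def)+
    have "F1 * F2 = exp (- (\<iota> * s))" by (simp add: F1_def F2_def algebra_simps flip: exp_add)
    then have "F1 * F2 < 1" using \<iota> elim by simp
    then have \<kappa>: "0 < \<kappa>" using F by (simp add: \<kappa>_def)
    have \<rho>: "z * (1 + F b) < 9 / 10" for b using elim by (cases b) (auto simp: F_def F1_def F2_def z_def)
    have zp: "0 < z * ((1 + F b) * (1 - z\<^sup>2))" for b
    proof -
      have "z * z < 1 * 1" using z by (intro mult_strict_mono) auto
      then show ?thesis using z F by (simp add: F_def power2_eq_square)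
    qed
    have Ule: "U b * ((1 + F b) * (1 - z\<^sup>2)) \<le> F b * (1 - z\<^sup>2 * (1 + F b))" for b
    proof (cases b)
      case True
      have "exp (sg * s) * (z * ((1 + F1) * (1 - z\<^sup>2))) \<le> exp (Q \<phi> k s) * (z * ((1 + F1) * (1 - z\<^sup>2)))"
        using elim zp[of True] by (intro mult_right_mono) (auto simp: F_def)
      also have "\<dots> = F1 * (1 - z\<^sup>2 * (1 + F1))"
        using \<rho>[of True] z by (intro Q_eq) (auto simp: z_def F1_def F_def)
      finally show ?thesis using True by (simp add: U_def F_def mult_ac)
    next
      case False
      have "1 * (z * ((1 + F2) * (1 - z\<^sup>2))) \<le> exp (Q (- (\<phi> + \<iota>)) k s) * (z * ((1 + F2) * (1 - z\<^sup>2)))"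
        using elim zp[of False] by (intro mult_right_mono) (auto simp: F_def)
      also have "\<dots> = F2 * (1 - z\<^sup>2 * (1 + F2))"
        using \<rho>[of False] z by (intro Q_eq) (auto simp: z_def F2_def F_def)
      finally show ?thesis using False by (simp add: U_def F_def mult_ac)
    qed
    interpret tilted z \<beta>0 \<kappa> U F X e "sg * s"
    proof (unfold_locales, goal_cases)
      case (8 b)
      show ?case using \<rho>[of b] by simp
    next
      case (10 b)
      have "U b * (1 + z * \<beta>0) \<le> 41 / 100 * (1 + 41 / 100 * \<beta>0)"
        using U[of b] z by (intro mult_mono add_mono) (auto simp: \<beta>0_def)
      then show ?case using z by (simp add: \<beta>0_def)
    next
      case (11 b)
      have *: "F1 * F2 + (F1 + 1) * \<kappa> = 1" using F by (simp add: \<kappa>_def)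
      show ?case
      proof (cases b)
        case True
        have "U False * \<kappa> \<le> 1 * \<kappa>" using U[of False] \<kappa> by (intro mult_right_mono) auto
        then show ?thesis using True by (simp add: X_def F_def)
      next
        case False
        have "U True * \<kappa> \<le> 1 * \<kappa>" using U[of True] \<kappa> by (intro mult_right_mono) auto
        then show ?thesis using False * by (simp add: X_def F_def algebra_simps)
      qed
    qed (use z F U \<kappa> Ule e in \<open>auto simp: \<beta>0_def F_def X_def U_def add_pos_pos\<close>)
    obtain C where C: "C > 0" "\<And>L e'. e' \<in> unit_steps \<Longrightarrow>
      (\<Sum>\<pi>\<in>prudent_paths L. exp (sg * s * real (width e \<pi>)) * \<beta>0 ^ near e' \<pi>) \<le> C / z ^ L"
      using tilted_sum_bounded by blast
    have "C / z ^ L = C / \<sigma> ^ L * exp ((speed * sg + \<eta>) * s * real L)" for L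
    proof -
      have "z ^ L = \<sigma> ^ L * exp (- (k * s * real L))"
        unfolding z_def by (simp add: power_mult_distrib mult.commute flip: exp_of_nat_mult)
      then show ?thesis by (simp add: k_def exp_minus divide_inverse)
    qed
    then show ?case using C by (intro exI[of _ C]) auto
  qed
qed

theorem card_lower_bound:
  "\<forall>\<^sub>F s in at_right 0. \<exists>C>0. \<exists>L0. \<forall>L\<ge>L0. C / \<sigma> ^ L * exp (- (s * real L)) \<le> real (card (prudent_paths L))"
proof -
  \<comment> \<open>Here \<open>z\<close> is raised to \<open>\<sigma> * exp s\<close>, that is
    \<open>k = -1\<close>; this \<iota> uses only half of the room, so the derivative of
    \<open>Q\<close> stays negative although \<open>F\<close> exceeds 1.\<close>
  define \<iota> where "\<iota> = qz / (2 * qF)"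
  have \<iota>: "0 < \<iota>" unfolding \<iota>_def using qz_pos qF_pos by simp
  have "\<iota> * qF + (-1) * qz = - (qz / 2)" unfolding \<iota>_def using qF_pos by (simp add: field_simps)
  then have 1: "\<iota> * qF + (-1) * qz < 0" using qz_pos by simp
  have "\<forall>\<^sub>F s in at_right (0::real). 0 < s" by (simp add: eventually_at_right_less)
  then show ?thesis
    using Q_lt[OF 1] params_small[of "-1" 0 \<iota>]
  proof eventually_elim
    case (elim s)
    define z where "z = \<sigma> * exp (- (-1 * s))"
    define F where "F = exp (\<iota> * s)"
    have z: "0 < z" "z < 41 / 100" using elim \<sigma>_pos by (auto simp: z_def)
    have F: "1 < F" using elim \<iota> by (simp add: F_def)
    have \<rho>: "z * (1 + F) < 9 / 10" using elim by (auto simp: F_def z_def)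
    have zz: "z * z < 1 * 1" using z by (intro mult_strict_mono) auto
    have "exp (Q \<iota> (-1) s) * (z * ((1 + F) * (1 - z\<^sup>2))) = F * (1 - z\<^sup>2 * (1 + F))"
      using \<rho> z by (intro Q_eq) (auto simp: z_def F_def)
    moreover have "exp (Q \<iota> (-1) s) * (z * ((1 + F) * (1 - z\<^sup>2))) \<le> 1 * (z * ((1 + F) * (1 - z\<^sup>2)))"
      using elim zz z F by (intro mult_right_mono) (auto simp: power2_eq_square)
    moreover have "z * (1 + z) \<le> 41 / 100 * (1 + 41 / 100)"
      using z by (intro mult_mono) auto
    ultimately interpret subsolution z F
      using z F \<rho> by unfold_locales auto
    have "z ^ L = \<sigma> ^ L * exp (s * real L)" for L
      unfolding z_def by (simp add: power_mult_distrib mult.commute flip: exp_of_nat_mult)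
    then show ?case using card_prudent_paths_ge by (simp add: exp_minus divide_inverse mult.assoc)
  qed
qed

section \<open>Concentration along the diagonals\<close>

lemma prudent_paths_take:
  assumes "\<pi> \<in> prudent_paths L" "k \<le> L"
  shows "take (Suc k) \<pi> \<in> prudent_paths k"
proof -
  have "(!) (take (Suc k) \<pi>) ` {0..i} = (!) \<pi> ` {0..i}" if "i < k" for i
    using that by (intro image_cong) auto
  then show ?thesis using assms unfolding prudent_paths_def by auto
qed

lemma take_Suc_grow:
  assumes "\<pi> \<in> prudent_paths L" "k < L"
  obtains d where "d \<in> unit_steps" "take (Suc (Suc k)) \<pi> = grow (take (Suc k) \<pi>) d"
proof -
  have "take (Suc (Suc k)) \<pi> \<in> prudent_paths (Suc k)" using assms by (intro prudent_paths_take) auto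
  then obtain \<rho> d where \<rho>: "take (Suc (Suc k)) \<pi> = grow \<rho> d" "\<rho> \<in> prudent_paths k" "d \<in> allowed \<rho>"
    by (auto simp: prudent_paths_Suc)
  have "take (Suc k) \<pi> = take (Suc k) (take (Suc (Suc k)) \<pi>)" by (simp add: min_def)
  also have "\<dots> = \<rho>" unfolding \<rho>(1) using prudent_paths_length[OF \<rho>(2)] by simp
  finally show ?thesis using that[of d] \<rho> by (auto intro: allowed_unit)
qed

lemma lattice_ray_shift: "q \<in> lattice_ray (p - v) d \<longleftrightarrow> q + v \<in> lattice_ray p d"
  by (cases q, cases p, cases v) (auto simp: lattice_ray_def algebra_simps)

lemma prudent_paths_drop:
  assumes "\<pi> \<in> prudent_paths L" "k \<le> L"
  shows "map (\<lambda>p. p - \<pi> ! k) (drop k \<pi>) \<in> prudent_paths (L - k)"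
proof -
  let ?\<rho> = "map (\<lambda>p. p - \<pi> ! k) (drop k \<pi>)"
  have len: "length \<pi> = Suc L" using assms(1) by (rule prudent_paths_length)
  have nth: "?\<rho> ! i = \<pi> ! (k + i) - \<pi> ! k" if "i \<le> L - k" for i
    using that len assms(2) by simp
  have "?\<rho> ! Suc i - ?\<rho> ! i \<in> unit_steps \<and>
      lattice_ray (?\<rho> ! i) (?\<rho> ! Suc i - ?\<rho> ! i) \<inter> (!) ?\<rho> ` {0..i} = {}" if i: "i < L - k" for i
  proof -
    have ki: "k + i < L" using i assms(2) by simp
    have st: "?\<rho> ! Suc i - ?\<rho> ! i = \<pi> ! Suc (k + i) - \<pi> ! (k + i)"
      using i nth[of i] nth[of "Suc i"] by simp
    have P: "\<pi> ! Suc (k + i) - \<pi> ! (k + i) \<in> unit_steps"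
      "lattice_ray (\<pi> ! (k + i)) (\<pi> ! Suc (k + i) - \<pi> ! (k + i)) \<inter> (!) \<pi> ` {0..k + i} = {}"
      using assms(1) ki unfolding prudent_paths_def by blast+
    have "q \<notin> lattice_ray (?\<rho> ! i) (?\<rho> ! Suc i - ?\<rho> ! i)" if "q \<in> (!) ?\<rho> ` {0..i}" for q
    proof -
      from that obtain j where j: "j \<le> i" "q = ?\<rho> ! j" by auto
      then have "q + \<pi> ! k = \<pi> ! (k + j)" using nth[of j] i by simp
      moreover have "\<pi> ! (k + j) \<in> (!) \<pi> ` {0..k + i}" using j by auto
      ultimately have "q + \<pi> ! k \<notin> lattice_ray (\<pi> ! (k + i)) (\<pi> ! Suc (k + i) - \<pi> ! (k + i))"
        using P(2) by auto
      then show ?thesis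
        unfolding st using i nth[of i] by (simp add: lattice_ray_shift)
    qed
    then show ?thesis using st P(1) by auto
  qed
  moreover have "length ?\<rho> = Suc (L - k)" using len assms(2) by simp
  moreover have "?\<rho> ! 0 = (0, 0)" using nth[of 0] by (simp add: zero_prod_def)
  ultimately show ?thesis unfolding prudent_paths_def by blast
qed

text \<open>A walk is determined by its prefix and by its suffix moved to the origin; the suffix
  stays prudent because it has fewer sites to avoid.\<close>

lemma card_prefix_in:
  assumes "k \<le> L" "B \<subseteq> prudent_paths k"
  shows "card {\<pi> \<in> prudent_paths L. take (Suc k) \<pi> \<in> B} \<le> card B * card (prudent_paths (L - k))"
proof -
  let ?S = "{\<pi> \<in> prudent_paths L. take (Suc k) \<pi> \<in> B}"
  let ?f = "\<lambda>\<pi>. (take (Suc k) \<pi>, map (\<lambda>p. p - \<pi> ! k) (drop k \<pi>))"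
  have inj: "inj_on ?f ?S"
  proof (rule inj_onI)
    fix \<pi> \<rho> assume *: "\<pi> \<in> ?S" "\<rho> \<in> ?S" "?f \<pi> = ?f \<rho>"
    have len: "length \<pi> = Suc L" "length \<rho> = Suc L" using * by (auto dest: prudent_paths_length)
    have t: "take (Suc k) \<pi> = take (Suc k) \<rho>" using *(3) by simp
    have "\<pi> ! k = take (Suc k) \<pi> ! k" by simp
    also have "\<dots> = \<rho> ! k" unfolding t by simp
    finally have k: "\<pi> ! k = \<rho> ! k" .
    have "inj (\<lambda>p. p - \<rho> ! k)" by (auto simp: inj_def)
    then have "drop k \<pi> = drop k \<rho>" using *(3) unfolding k by (simp add: inj_map_eq_map)
    moreover have "take k \<pi> = take k \<rho>" using arg_cong[OF t, of "take k"] by (simp add: min_def)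
    ultimately show "\<pi> = \<rho>" by (metis append_take_drop_id)
  qed
  have "card ?S = card (?f ` ?S)" using inj by (simp add: card_image)
  also have "\<dots> \<le> card (B \<times> prudent_paths (L - k))"
    using assms by (intro card_mono) (auto intro: prudent_paths_drop finite_subset[OF _ finite_prudent_paths] simp: finite_prudent_paths)
  finally show ?thesis by (simp add: card_cartesian_product)
qed

text \<open>The scale is \<open>1 / \<sigma> ^ L\<close> instead of the number of walks, so that
  bounds for a prefix and for its continuation multiply exactly.\<close>

definition rare :: "(nat \<Rightarrow> (int \<times> int) list set) \<Rightarrow> bool" where
  "rare A \<longleftrightarrow> (\<exists>C>0. \<exists>\<delta>>0. \<forall>L. real (card (A L)) \<le> C / \<sigma> ^ L * exp (- (\<delta> * real L)))"

lemma rare_Un: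
  assumes "rare A" "rare B"
  shows "rare (\<lambda>L. A L \<union> B L)"
proof -
  obtain C \<delta> where 1: "C > 0" "\<delta> > 0" "\<And>L. real (card (A L)) \<le> C / \<sigma> ^ L * exp (- (\<delta> * real L))"
    using assms(1) unfolding rare_def by blast
  obtain C' \<delta>' where 2: "C' > 0" "\<delta>' > 0" "\<And>L. real (card (B L)) \<le> C' / \<sigma> ^ L * exp (- (\<delta>' * real L))"
    using assms(2) unfolding rare_def by blast
  have "real (card (A L \<union> B L)) \<le> (C + C') / \<sigma> ^ L * exp (- (min \<delta> \<delta>' * real L))" for L
  proof -
    have "real (card (A L \<union> B L)) \<le> real (card (A L)) + real (card (B L))"
      using card_Un_le[of "A L" "B L"] by linarith
    also have "\<dots> \<le> C / \<sigma> ^ L * exp (- (\<delta> * real L)) + C' / \<sigma> ^ L * exp (- (\<delta>' * real L))"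
      using 1(3)[of L] 2(3)[of L] by linarith
    also have "\<dots> \<le> C / \<sigma> ^ L * exp (- (min \<delta> \<delta>' * real L)) + C' / \<sigma> ^ L * exp (- (min \<delta> \<delta>' * real L))"
      using 1 2 \<sigma>_pos by (intro add_mono mult_left_mono) (auto intro!: mult_right_mono)
    finally show ?thesis by (simp add: add_divide_distrib distrib_right)
  qed
  then show ?thesis unfolding rare_def using 1 2 by (intro exI[of _ "C + C'"] conjI exI[of _ "min \<delta> \<delta>'"]) auto
qed

lemma rare_subset:
  assumes "rare B" "\<And>L. A L \<subseteq> B L" "\<And>L. finite (B L)"
  shows "rare A"
  using assms(1) card_mono[OF assms(3,2)] unfolding rare_def
  by (meson of_nat_mono order_trans)

lemma card_mult_le_sum:
  fixes f :: "'a \<Rightarrow> real"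
  assumes "finite S" "A \<subseteq> S" "\<And>x. x \<in> S \<Longrightarrow> 0 \<le> f x" "\<And>x. x \<in> A \<Longrightarrow> b \<le> f x"
  shows "real (card A) * b \<le> sum f S"
proof -
  have "real (card A) * b \<le> sum f A"
    using assms by (intro sum_bounded_below) auto
  also have "\<dots> \<le> sum f S" using assms by (intro sum_mono2) auto
  finally show ?thesis .
qed

text \<open>The exponential Markov inequality: \<open>f\<close> is large on \<open>A L\<close>,
  while its total grows at a rate smaller by \<delta>.\<close>

lemma rareI:
  fixes f :: "(int \<times> int) list \<Rightarrow> real"
  assumes "\<And>L. A L \<subseteq> prudent_paths L" "\<And>\<pi>. 0 \<le> f \<pi>" "0 < C" "0 < \<delta>"
    and "\<And>L \<pi>. \<pi> \<in> A L \<Longrightarrow> exp (h * real L) \<le> f \<pi>"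
    and "\<And>L. sum f (prudent_paths L) \<le> C / \<sigma> ^ L * exp (h' * real L)"
    and "h' + \<delta> \<le> h"
  shows "rare A"
proof -
  have "real (card (A L)) \<le> C / \<sigma> ^ L * exp (- (\<delta> * real L))" for L
  proof -
  have "real (card (A L)) * exp (h * real L) \<le> sum f (prudent_paths L)"
    using assms by (intro card_mult_le_sum) (auto simp: finite_prudent_paths)
  also have "\<dots> \<le> C / \<sigma> ^ L * exp (h' * real L)" by (rule assms)
  also have "\<dots> \<le> C / \<sigma> ^ L * (exp (- (\<delta> * real L)) * exp (h * real L))"
    using assms(3,7) \<sigma>_pos mult_right_mono[OF assms(7), of "real L"]
    by (intro mult_left_mono) (auto simp: algebra_simps simp flip: exp_add)
  finally have "real (card (A L)) * exp (h * real L) \<le> (C / \<sigma> ^ L * exp (- (\<delta> * real L))) * exp (h * real L)"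
    by (simp only: mult.assoc)
  then show ?thesis by (rule mult_right_le_imp_le) simp
  qed
  then show ?thesis unfolding rare_def using assms(3,4) by blast
qed

lemma obtain_tilt:
  assumes "sg = 1 \<or> sg = -1" "0 < \<eta>" "e \<in> unit_steps" "0 < s0"
  obtains s C where "0 < s" "s < s0" "0 < C" "\<And>L e'. e' \<in> unit_steps \<Longrightarrow>
    (\<Sum>\<pi>\<in>prudent_paths L. exp (sg * s * real (width e \<pi>)) * \<beta>0 ^ near e' \<pi>)
      \<le> C / \<sigma> ^ L * exp ((speed * sg + \<eta>) * s * real L)"
proof -
  have "\<forall>\<^sub>F s in at_right 0. s \<in> {0<..<s0}" using assms(4) by (rule eventually_at_right_real)
  then have "\<forall>\<^sub>F s in at_right 0. (\<exists>C>0. \<forall>L. \<forall>e'\<in>unit_steps.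
    (\<Sum>\<pi>\<in>prudent_paths L. exp (sg * s * real (width e \<pi>)) * \<beta>0 ^ near e' \<pi>)
      \<le> C / \<sigma> ^ L * exp ((speed * sg + \<eta>) * s * real L)) \<and> s \<in> {0<..<s0}"
    using tilted_bound[OF _ assms(2,3), of sg] assms(1) by (intro eventually_conj) auto
  from eventually_happens'[OF trivial_limit_at_right_real this]
  show ?thesis using that by auto
qed

lemma \<beta>0_gt1: "1 < \<beta>0" by (simp add: \<beta>0_def)

text \<open>For a positive tilt all weights are at least 1, so the tilted sum dominates the count; a
  small \<open>s\<close> makes its extra growth negligible.\<close>

lemma card_upper_bound:
  assumes "0 < \<eta>"
  obtains C where "0 < C" "\<And>L. real (card (prudent_paths L)) \<le> C / \<sigma> ^ L * exp (\<eta> * real L)"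
proof -
  have e: "(1, 0) \<in> unit_steps" by (simp add: unit_steps_def)
  have pos: "0 < \<eta> / (speed + 1)" using assms speed_pos by simp
  obtain s C where s: "0 < s" "s < \<eta> / (speed + 1)" "0 < C" "\<And>L e'. e' \<in> unit_steps \<Longrightarrow>
    (\<Sum>\<pi>\<in>prudent_paths L. exp (1 * s * real (width (1, 0) \<pi>)) * \<beta>0 ^ near e' \<pi>)
      \<le> C / \<sigma> ^ L * exp ((speed * 1 + 1) * s * real L)"
    using obtain_tilt[OF disjI1[OF refl] zero_less_one e pos] by blast
  have "real (card (prudent_paths L)) \<le> C / \<sigma> ^ L * exp (\<eta> * real L)" for L
  proof -
    have "real (card (prudent_paths L)) * 1 \<le>
        (\<Sum>\<pi>\<in>prudent_paths L. exp (1 * s * real (width (1, 0) \<pi>)) * \<beta>0 ^ near (1, 0) \<pi>)"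
      using s(1) \<beta>0_gt1 mult_mono[of 1 "exp _" 1 "\<beta>0 ^ _"]
      by (intro card_mult_le_sum) (auto simp: finite_prudent_paths intro!: mult_nonneg_nonneg)
    also have "\<dots> \<le> C / \<sigma> ^ L * exp ((speed * 1 + 1) * s * real L)" using s(4) e by blast
    also have "\<dots> \<le> C / \<sigma> ^ L * exp (\<eta> * real L)"
    proof -
      have "(speed * 1 + 1) * s \<le> \<eta>" using s(2) speed_pos by (simp add: less_divide_eq mult.commute)
      then have "(speed * 1 + 1) * s * real L \<le> \<eta> * real L" by (intro mult_right_mono) auto
      then show ?thesis using s(3) \<sigma>_pos by (intro mult_left_mono) auto
    qed
    finally show ?thesis by simp
  qed
  then show ?thesis using that s by blast
qed

lemma card_lower_bound':
  assumes "0 < \<eta>"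
  obtains C L0 where "0 < C" "\<And>L. L \<ge> L0 \<Longrightarrow> C / \<sigma> ^ L * exp (- (\<eta> * real L)) \<le> real (card (prudent_paths L))"
proof -
  have "\<forall>\<^sub>F s in at_right 0. s \<in> {0<..<\<eta>}" using assms by (rule eventually_at_right_real)
  then have "\<forall>\<^sub>F s in at_right 0. (\<exists>C>0. \<exists>L0. \<forall>L\<ge>L0. C / \<sigma> ^ L * exp (- (s * real L)) \<le> real (card (prudent_paths L)))
      \<and> s \<in> {0<..<\<eta>}"
    using card_lower_bound by eventually_elim simp
  from eventually_happens'[OF trivial_limit_at_right_real this]
  obtain s C L0 where s: "0 < s" "s < \<eta>" "0 < C"
    "\<And>L. L \<ge> L0 \<Longrightarrow> C / \<sigma> ^ L * exp (- (s * real L)) \<le> real (card (prudent_paths L))" by auto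
  have "C / \<sigma> ^ L * exp (- (\<eta> * real L)) \<le> real (card (prudent_paths L))" if "L \<ge> L0" for L
  proof -
    have "C / \<sigma> ^ L * exp (- (\<eta> * real L)) \<le> C / \<sigma> ^ L * exp (- (s * real L))"
      using s \<sigma>_pos by (intro mult_left_mono) (auto intro!: mult_right_mono)
    with s(4)[OF that] show ?thesis by linarith
  qed
  then show ?thesis using that s by blast
qed

definition typical :: "real \<Rightarrow> int \<times> int \<Rightarrow> nat \<Rightarrow> (int \<times> int) list \<Rightarrow> bool" where
  "typical \<epsilon> e L \<pi> \<longleftrightarrow> \<bar>real (width e \<pi>) - speed * real L\<bar> \<le> \<epsilon> * real L \<and> real (near e \<pi>) \<le> \<epsilon> * real L"

lemma rare_atypical:
  assumes \<epsilon>: "0 < \<epsilon>" and e: "e \<in> unit_steps"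
  shows "rare (\<lambda>L. {\<pi> \<in> prudent_paths L. \<not> typical \<epsilon> e L \<pi>})"
proof -
  have \<beta>1: "1 \<le> \<beta>0 ^ n" for n using \<beta>0_gt1 by simp
  have up: "rare (\<lambda>L. {\<pi> \<in> prudent_paths L. (speed + \<epsilon>) * real L \<le> real (width e \<pi>)})"
  proof -
    obtain s C where s: "0 < s" "s < 1" "0 < C" "\<And>L e'. e' \<in> unit_steps \<Longrightarrow>
      (\<Sum>\<pi>\<in>prudent_paths L. exp (1 * s * real (width e \<pi>)) * \<beta>0 ^ near e' \<pi>)
        \<le> C / \<sigma> ^ L * exp ((speed * 1 + \<epsilon> / 2) * s * real L)"
      using obtain_tilt[OF disjI1[OF refl] half_gt_zero[OF \<epsilon>] e zero_less_one] by blast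
    show ?thesis
    proof (rule rareI[where h = "s * (speed + \<epsilon>)" and \<delta> = "s * \<epsilon> / 2"
          and f = "\<lambda>\<pi>. exp (1 * s * real (width e \<pi>)) * \<beta>0 ^ near e \<pi>", OF _ _ s(3) _ _ s(4)[OF e]])
      fix L \<pi> assume "\<pi> \<in> {\<pi> \<in> prudent_paths L. (speed + \<epsilon>) * real L \<le> real (width e \<pi>)}"
      then have "s * ((speed + \<epsilon>) * real L) \<le> s * real (width e \<pi>)" using s by (intro mult_left_mono) auto
      then have "exp (s * (speed + \<epsilon>) * real L) \<le> exp (1 * s * real (width e \<pi>)) * 1" by (simp add: mult_ac)
      also have "\<dots> \<le> exp (1 * s * real (width e \<pi>)) * \<beta>0 ^ near e \<pi>" using \<beta>1 by (intro mult_left_mono) auto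
      finally show "exp (s * (speed + \<epsilon>) * real L) \<le> exp (1 * s * real (width e \<pi>)) * \<beta>0 ^ near e \<pi>" .
    qed (use \<epsilon> s \<beta>0_gt1 in \<open>auto simp: algebra_simps\<close>)
  qed
  have down: "rare (\<lambda>L. {\<pi> \<in> prudent_paths L. real (width e \<pi>) \<le> (speed - \<epsilon>) * real L})"
  proof -
    obtain s C where s: "0 < s" "s < 1" "0 < C" "\<And>L e'. e' \<in> unit_steps \<Longrightarrow>
      (\<Sum>\<pi>\<in>prudent_paths L. exp (-1 * s * real (width e \<pi>)) * \<beta>0 ^ near e' \<pi>)
        \<le> C / \<sigma> ^ L * exp ((speed * -1 + \<epsilon> / 2) * s * real L)"
      using obtain_tilt[OF disjI2[OF refl] half_gt_zero[OF \<epsilon>] e zero_less_one] by blast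
    show ?thesis
    proof (rule rareI[where h = "- s * (speed - \<epsilon>)" and \<delta> = "s * \<epsilon> / 2"
          and f = "\<lambda>\<pi>. exp (-1 * s * real (width e \<pi>)) * \<beta>0 ^ near e \<pi>", OF _ _ s(3) _ _ s(4)[OF e]])
      fix L \<pi> assume "\<pi> \<in> {\<pi> \<in> prudent_paths L. real (width e \<pi>) \<le> (speed - \<epsilon>) * real L}"
      then have "s * real (width e \<pi>) \<le> s * ((speed - \<epsilon>) * real L)" using s by (intro mult_left_mono) auto
      then have "exp (- s * (speed - \<epsilon>) * real L) \<le> exp (-1 * s * real (width e \<pi>)) * 1" by (simp add: mult_ac)
      also have "\<dots> \<le> exp (-1 * s * real (width e \<pi>)) * \<beta>0 ^ near e \<pi>" using \<beta>1 by (intro mult_left_mono) auto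
      finally show "exp (- s * (speed - \<epsilon>) * real L) \<le> exp (-1 * s * real (width e \<pi>)) * \<beta>0 ^ near e \<pi>" .
    qed (use \<epsilon> s \<beta>0_gt1 in \<open>auto simp: algebra_simps\<close>)
  qed
  have far: "rare (\<lambda>L. {\<pi> \<in> prudent_paths L. \<epsilon> * real L \<le> real (near e \<pi>)})"
  proof -
    have ln: "0 < ln \<beta>0" using \<beta>0_gt1 by simp
    \<comment> \<open>Here the tilt is only a nuisance: \<open>s\<close> is taken so small that it
      costs at most half of the gain \<open>\<epsilon> * ln \<beta>0\<close> from the factor
      \<open>\<beta>0 ^ near\<close>.\<close>
    have pos: "0 < \<epsilon> * ln \<beta>0 / 2 / (speed + 1)" using \<epsilon> ln speed_pos by simp
    obtain s C where s: "0 < s" "s < \<epsilon> * ln \<beta>0 / 2 / (speed + 1)" "0 < C" "\<And>L e'. e' \<in> unit_steps \<Longrightarrow>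
      (\<Sum>\<pi>\<in>prudent_paths L. exp (1 * s * real (width e \<pi>)) * \<beta>0 ^ near e' \<pi>)
        \<le> C / \<sigma> ^ L * exp ((speed * 1 + 1) * s * real L)"
      using obtain_tilt[OF disjI1[OF refl] zero_less_one e pos] by blast
    show ?thesis
    proof (rule rareI[where h = "\<epsilon> * ln \<beta>0" and \<delta> = "\<epsilon> * ln \<beta>0 / 2"
          and f = "\<lambda>\<pi>. exp (1 * s * real (width e \<pi>)) * \<beta>0 ^ near e \<pi>", OF _ _ s(3) _ _ s(4)[OF e]])
      fix L \<pi> assume "\<pi> \<in> {\<pi> \<in> prudent_paths L. \<epsilon> * real L \<le> real (near e \<pi>)}"
      then have "\<epsilon> * real L * ln \<beta>0 \<le> real (near e \<pi>) * ln \<beta>0" using ln by (intro mult_right_mono) auto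
      then have "exp (\<epsilon> * ln \<beta>0 * real L) \<le> exp (real (near e \<pi>) * ln \<beta>0)" by (simp add: mult_ac)
      also have "\<dots> = 1 * \<beta>0 ^ near e \<pi>" using \<beta>0_gt1 by (simp add: exp_of_nat_mult)
      also have "\<dots> \<le> exp (1 * s * real (width e \<pi>)) * \<beta>0 ^ near e \<pi>" using s \<beta>0_gt1 by (intro mult_right_mono) auto
      finally show "exp (\<epsilon> * ln \<beta>0 * real L) \<le> exp (1 * s * real (width e \<pi>)) * \<beta>0 ^ near e \<pi>" .
    next
      show "(speed * 1 + 1) * s + \<epsilon> * ln \<beta>0 / 2 \<le> \<epsilon> * ln \<beta>0"
      proof -
        have sp: "0 < speed + 1" using speed_pos by simp
        have "s * (speed + 1) < \<epsilon> * ln \<beta>0 / 2" using s(2) unfolding pos_less_divide_eq[OF sp] .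
        moreover have "(speed * 1 + 1) * s = s * (speed + 1)" by simp
        ultimately show ?thesis by linarith
      qed
    qed (use \<epsilon> s \<beta>0_gt1 ln in auto)
  qed
  show ?thesis
    by (rule rare_subset[OF rare_Un[OF up rare_Un[OF down far]]])
      (auto simp: typical_def abs_le_iff algebra_simps finite_prudent_paths)
qed

section \<open>From typical prefixes to one fixed diagonal\<close>

lemma take_nth_last:
  assumes "\<pi> \<in> prudent_paths L" "k \<le> L"
  shows "last (take (Suc k) \<pi>) = \<pi> ! k"
proof -
  have "k < length \<pi>" using prudent_paths_length[OF assms(1)] assms(2) by simp
  then show ?thesis by (simp add: take_Suc_conv_app_nth)
qed

lemma ip_nth_le:
  assumes "\<pi> \<in> prudent_paths L" "e \<in> unit_steps" "k \<le> L"
  shows "\<bar>ip e (\<pi> ! k)\<bar> \<le> int k"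
  using assms(3)
proof (induction k)
  case 0
  then show ?case using assms(1) by (simp add: prudent_paths_def ip_def)
next
  case (Suc k)
  then have "\<pi> ! Suc k - \<pi> ! k \<in> unit_steps" using assms(1) by (simp add: prudent_paths_def)
  from ip_unit_le[OF assms(2) this] show ?case using Suc by (simp add: ip_diff)
qed

lemma extent_take_bounds:
  assumes "\<pi> \<in> prudent_paths L" "e \<in> unit_steps" "k \<le> L"
  shows "0 \<le> extent e (take (Suc k) \<pi>)" "extent e (take (Suc k) \<pi>) \<le> int k"
proof -
  let ?\<rho> = "take (Suc k) \<pi>"
  have len: "length \<pi> = Suc L" using assms(1) by (rule prudent_paths_length)
  have "?\<rho> ! 0 \<in> set ?\<rho>" using len by (intro nth_mem) simp
  moreover have "?\<rho> ! 0 = (0, 0)" using assms(1) by (simp add: prudent_paths_def)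
  ultimately have "ip e (0, 0) \<le> extent e ?\<rho>" by (metis ip_le_extent)
  then show "0 \<le> extent e ?\<rho>" by (simp add: ip_def)
  have "ip e p \<le> int k" if p: "p \<in> set ?\<rho>" for p
  proof -
    obtain i where "i < length ?\<rho>" "p = ?\<rho> ! i" using p by (metis in_set_conv_nth)
    then have i: "i \<le> k" "p = \<pi> ! i" using len by auto
    then have "\<bar>ip e p\<bar> \<le> int i" using ip_nth_le[OF assms(1,2), of i] assms(3) by simp
    then show ?thesis using i by simp
  qed
  moreover have "?\<rho> \<noteq> []" using len by auto
  ultimately show "extent e ?\<rho> \<le> int k" unfolding extent_def by (subst Max_le_iff) auto
qed

text \<open>While the box is wide compared with the distance to its nearest side, the walk cannot change
  the nearest side and the opposite side stays frozen.\<close>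

lemma near_side_constant:
  assumes \<pi>: "\<pi> \<in> prudent_paths L" and e: "e \<in> unit_steps" and "k0 \<le> L"
    and \<epsilon>: "0 < \<epsilon>" "4 * \<epsilon> < speed" "1 \<le> \<epsilon> * real k0"
    and ty: "\<And>k. k0 \<le> k \<Longrightarrow> k \<le> L \<Longrightarrow> typical \<epsilon> e k (take (Suc k) \<pi>)"
  obtains q where "q \<in> {e, - e}"
    "\<And>k. k0 \<le> k \<Longrightarrow> k \<le> L \<Longrightarrow> real (gap q (take (Suc k) \<pi>)) \<le> \<epsilon> * real k \<and>
      extent (- q) (take (Suc k) \<pi>) = extent (- q) (take (Suc k0) \<pi>)"
proof -
  let ?p = "\<lambda>k. take (Suc k) \<pi>"
  have "real (near e (?p k0)) \<le> \<epsilon> * real k0" using ty assms(3) by (simp add: typical_def)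
  then obtain q where q: "q \<in> {e, - e}" "real (gap q (?p k0)) \<le> \<epsilon> * real k0"
    unfolding near_def by (metis insertI1 insertI2 min_def)
  have qu: "q \<in> unit_steps" using q(1) e by auto
  have tyq: "\<bar>real (gap q (?p k)) + real (gap (- q) (?p k)) - speed * real k\<bar> \<le> \<epsilon> * real k"
    "real (min (gap q (?p k)) (gap (- q) (?p k))) \<le> \<epsilon> * real k" if "k0 \<le> k" "k \<le> L" for k
    using ty[OF that] q(1) by (auto simp: typical_def width_def near_def add.commute min.commute)
  have "real (gap q (?p k)) \<le> \<epsilon> * real k \<and> extent (- q) (?p k) = extent (- q) (?p k0)" if "k0 \<le> k" "k \<le> L" for k
    using that
  proof (induction k rule: dec_induct)
    case base
    then show ?case using q by simp
  next
    case (step k)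
    then have IH: "real (gap q (?p k)) \<le> \<epsilon> * real k" "extent (- q) (?p k) = extent (- q) (?p k0)" by auto
    obtain d where d: "d \<in> unit_steps" "?p (Suc k) = grow (?p k) d"
      using take_Suc_grow[OF \<pi>, of k] step by auto
    have ne: "?p k \<noteq> []" using prudent_paths_ne[OF \<pi>] by simp
    have "\<epsilon> * real k0 \<le> \<epsilon> * real k" using \<epsilon>(1) step by (intro mult_left_mono) auto
    then have \<epsilon>k: "1 \<le> \<epsilon> * real k" using \<epsilon>(3) by linarith
    have sp: "4 * (\<epsilon> * real n) \<le> speed * real n" for n using mult_right_mono[of "4 * \<epsilon>" speed "real n"] \<epsilon>(2) by simp
    have tk: "k0 \<le> k" "k \<le> L" and tk': "k0 \<le> Suc k" "Suc k \<le> L" using step by auto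
    have ipd: "\<bar>ip q d\<bar> \<le> 1" "\<bar>ip (- q) d\<bar> \<le> 1" using ip_unit_le[OF _ d(1)] qu by auto
    have "int (gap q (?p (Suc k))) \<le> int (gap q (?p k)) + 1"
      unfolding d(2) gap_grow[OF ne] using ipd by auto
    then have g1: "real (gap q (?p (Suc k))) \<le> \<epsilon> * real k + 1" using IH(1) by linarith
    \<comment> \<open>Otherwise \<open>- q\<close> would be the near side. As \<open>gap q\<close>
      has grown by at most 1, the width would be below \<open>3 * \<epsilon> * Suc k\<close>, but it
      is at least \<open>(speed - \<epsilon>) * Suc k\<close>.\<close>
    have A: "real (gap q (?p (Suc k))) \<le> \<epsilon> * real (Suc k)"
    proof (rule ccontr)
      assume "\<not> ?thesis"
      then have "real (gap (- q) (?p (Suc k))) \<le> \<epsilon> * real (Suc k)"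
        using tyq(2)[OF tk'] by (auto simp: min_def split: if_splits)
      moreover have "\<epsilon> * real (Suc k) = \<epsilon> * real k + \<epsilon>" by (simp add: algebra_simps)
      ultimately show False using g1 tyq(1)[OF tk'] \<epsilon>k sp[of "Suc k"] \<epsilon>(1) by linarith
    qed
    have "real (gap (- q) (?p k)) \<ge> 1"
      using IH(1) tyq(1)[OF tk] \<epsilon>k sp[of k] by linarith
    then have "ip (- q) (last (?p k)) + 1 \<le> extent (- q) (?p k)"
      using gap_int[OF ne, of "- q"] by linarith
    then have "extent (- q) (?p (Suc k)) = extent (- q) (?p k)"
      unfolding d(2) extent_grow[OF ne] using ipd by auto
    then show ?case using A IH(2) by simp
  qed
  then show ?thesis using that[OF q(1)] by blast
qed

text \<open>The coordinate along \<open>q\<close> is the width minus the gap to the near side minus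
  the extent on the far side; the latter is frozen since time \<open>k0\<close> and thus at most
  \<open>k0\<close>. Earlier times satisfy the trivial bound.\<close>

lemma axis_close:
  assumes \<pi>: "\<pi> \<in> prudent_paths L" and e: "e \<in> unit_steps" and "k0 \<le> L"
    and \<epsilon>: "0 < \<epsilon>" "4 * \<epsilon> < speed" "1 \<le> \<epsilon> * real k0"
    and ty: "\<And>k. k0 \<le> k \<Longrightarrow> k \<le> L \<Longrightarrow> typical \<epsilon> e k (take (Suc k) \<pi>)"
  shows "\<exists>q\<in>{e, - e}. \<forall>k\<le>L. \<bar>real_of_int (ip q (\<pi> ! k)) - speed * real k\<bar> \<le> 2 * \<epsilon> * real L + (1 + speed) * real k0"
proof -
  obtain q where q: "q \<in> {e, - e}"
    "\<And>k. k0 \<le> k \<Longrightarrow> k \<le> L \<Longrightarrow> real (gap q (take (Suc k) \<pi>)) \<le> \<epsilon> * real k \<and>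
      extent (- q) (take (Suc k) \<pi>) = extent (- q) (take (Suc k0) \<pi>)"
    using near_side_constant[OF assms] by blast
  have qu: "q \<in> unit_steps" using q(1) e by auto
  have "\<bar>real_of_int (ip q (\<pi> ! k)) - speed * real k\<bar> \<le> 2 * \<epsilon> * real L + (1 + speed) * real k0"
    if k: "k \<le> L" for k
  proof (cases "k0 \<le> k")
    case True
    let ?p = "take (Suc k) \<pi>"
    have ne: "?p \<noteq> []" using prudent_paths_ne[OF \<pi>] by simp
    have last: "last ?p = \<pi> ! k" using take_nth_last[OF \<pi> k] .
    have x: "extent (- q) ?p = extent (- q) (take (Suc k0) \<pi>)" "real (gap q ?p) \<le> \<epsilon> * real k"
      using q(2)[OF True k] by auto
    have x0: "0 \<le> extent (- q) ?p" "extent (- q) ?p \<le> int k0"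
      unfolding x(1) using extent_take_bounds[OF \<pi> _ assms(3), of "- q"] qu by auto
    have "int (gap (- q) ?p) = extent (- q) ?p + ip q (\<pi> ! k)"
      using gap_int[OF ne, of "- q"] last by (simp add: ip_neg)
    then have "ip q (\<pi> ! k) = int (width q ?p) - int (gap q ?p) - extent (- q) ?p"
      by (simp add: width_def)
    then have eq: "real_of_int (ip q (\<pi> ! k)) = real (width q ?p) - real (gap q ?p) - real_of_int (extent (- q) ?p)"
      by simp
    have w: "\<bar>real (width q ?p) - speed * real k\<bar> \<le> \<epsilon> * real k"
      using ty[OF True k] q(1) by (auto simp: typical_def)
    have "\<epsilon> * real k \<le> \<epsilon> * real L" using \<epsilon>(1) k by simp
    moreover have "0 \<le> speed * real k0" using speed_pos by simp
    moreover have "0 \<le> real_of_int (extent (- q) ?p)" "real_of_int (extent (- q) ?p) \<le> real k0" using x0 by linarith+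
    ultimately show ?thesis unfolding eq using w x(2) by (simp add: algebra_simps)
  next
    case False
    have "\<bar>real_of_int (ip q (\<pi> ! k))\<bar> \<le> real k" using ip_nth_le[OF \<pi> qu k] by linarith
    moreover have "speed * real k \<le> speed * real k0" using speed_pos False by simp
    moreover have "0 \<le> speed * real k" "0 \<le> \<epsilon> * real L" using speed_pos \<epsilon>(1) by auto
    ultimately show ?thesis using False by (simp add: algebra_simps)
  qed
  then show ?thesis using q(1) by blast
qed

lemma interpolation_close:
  fixes f :: "nat \<Rightarrow> real"
  assumes f: "\<And>k. k \<le> L \<Longrightarrow> \<bar>f k - c * real k\<bar> \<le> D" and t: "0 \<le> t" "t \<le> 1"
  defines "k \<equiv> nat \<lfloor>t * real L\<rfloor>"
  shows "\<bar>f k + (t * real L - real k) * (f (Suc k) - f k) - c * t * real L\<bar> \<le> D"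
proof -
  define \<theta> where "\<theta> = t * real L - real k"
  have tL: "0 \<le> t * real L" "t * real L \<le> real L" using t mult_right_mono[of t 1 "real L"] by auto
  have k: "real k \<le> t * real L" "t * real L < real k + 1" unfolding k_def using tL by linarith+
  have \<theta>: "0 \<le> \<theta>" "\<theta> \<le> 1" using k by (auto simp: \<theta>_def)
  have kL: "k \<le> L" using k tL by linarith
  show ?thesis
  proof (cases "k = L")
    \<comment> \<open>At the right end the interpolation weight is zero, so the value of
      \<open>f\<close> beyond \<open>L\<close> does not enter.\<close>
    case True
    then have tk: "t * real L = real k" using k tL by linarith
    then have e: "c * t * real L = c * real k" by (simp add: mult.assoc)
    show ?thesis unfolding e using f[OF kL] tk by simp
  next
    case False
    have "c * t * real L = (1 - \<theta>) * (c * real k) + \<theta> * (c * real (Suc k))"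
      by (simp add: \<theta>_def algebra_simps)
    then have "f k + \<theta> * (f (Suc k) - f k) - c * t * real L =
        (1 - \<theta>) * (f k - c * real k) + \<theta> * (f (Suc k) - c * real (Suc k))"
      by (simp add: algebra_simps)
    also have "\<bar>\<dots>\<bar> \<le> (1 - \<theta>) * \<bar>f k - c * real k\<bar> + \<theta> * \<bar>f (Suc k) - c * real (Suc k)\<bar>"
      using \<theta> by (intro order_trans[OF abs_triangle_ineq]) (simp add: abs_mult)
    also have "\<dots> \<le> (1 - \<theta>) * D + \<theta> * D"
      using \<theta> f[OF kL] f[of "Suc k"] kL False by (intro add_mono mult_left_mono) auto
    finally show ?thesis by (simp add: \<theta>_def algebra_simps)
  qed
qed

lemma rescaled_path_close:
  assumes L: "0 < L"
    and x: "\<And>k. k \<le> L \<Longrightarrow> \<bar>real_of_int (fst (\<pi> ! k)) - c * u * real k\<bar> \<le> D"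
    and y: "\<And>k. k \<le> L \<Longrightarrow> \<bar>real_of_int (snd (\<pi> ! k)) - c * v * real k\<bar> \<le> D"
    and t: "t \<in> {0..1}"
  shows "norm (rescaled_path L \<pi> t - (c * t) *\<^sub>R (u, v)) \<le> 2 * D / real L"
proof -
  define k where "k = nat \<lfloor>t * real L\<rfloor>"
  define X where "X = real_of_int (fst (\<pi> ! k)) + (t * real L - real k) * (real_of_int (fst (\<pi> ! Suc k)) - real_of_int (fst (\<pi> ! k))) - c * u * t * real L"
  define Y where "Y = real_of_int (snd (\<pi> ! k)) + (t * real L - real k) * (real_of_int (snd (\<pi> ! Suc k)) - real_of_int (snd (\<pi> ! k))) - c * v * t * real L"
  have X: "\<bar>X\<bar> \<le> D"
    unfolding X_def k_def by (rule interpolation_close) (use x t in auto)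
  have Y: "\<bar>Y\<bar> \<le> D"
    unfolding Y_def k_def by (rule interpolation_close) (use y t in auto)
  have "rescaled_path L \<pi> t - (c * t) *\<^sub>R (u, v) = (X / real L, Y / real L)"
    using L unfolding rescaled_path_def Let_def k_def[symmetric] X_def Y_def
    by (simp add: to_plane_def prod_eq_iff field_simps)
  also have "norm \<dots> \<le> \<bar>X\<bar> / real L + \<bar>Y\<bar> / real L"
    using norm_Pair_le[of "X / real L" "Y / real L"] by simp
  also have "\<dots> \<le> D / real L + D / real L" using X Y L by (intro add_mono divide_right_mono) auto
  finally show ?thesis by (simp add: field_simps)
qed

definition tracks_diagonal :: "real \<Rightarrow> nat \<Rightarrow> (int \<times> int) list set" where
  "tracks_diagonal \<epsilon> L = {\<pi>. \<exists>i\<in>{1, 2, 3, 4}.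
     (SUP t\<in>{0..1}. norm (rescaled_path L \<pi> t - (speed * t) *\<^sub>R diag_dir i)) \<le> \<epsilon>}"

lemma typical_imp_tracks:
  assumes \<pi>: "\<pi> \<in> prudent_paths L" and "0 < L" "k0 \<le> L"
    and \<epsilon>: "0 < \<epsilon>" "4 * \<epsilon> < speed" "1 \<le> \<epsilon> * real k0"
    and ty: "\<And>e k. e \<in> unit_steps \<Longrightarrow> k0 \<le> k \<Longrightarrow> k \<le> L \<Longrightarrow> typical \<epsilon> e k (take (Suc k) \<pi>)"
    and D: "2 * (2 * \<epsilon> * real L + (1 + speed) * real k0) \<le> \<epsilon>' * real L"
  shows "\<pi> \<in> tracks_diagonal \<epsilon>' L"
proof -
  let ?D = "2 * \<epsilon> * real L + (1 + speed) * real k0"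
  have u: "(1, 0) \<in> unit_steps" "(0, 1) \<in> unit_steps" by (auto simp: unit_steps_def)
  obtain p where p: "p \<in> {(1, 0), - (1, 0)}"
    "\<And>k. k \<le> L \<Longrightarrow> \<bar>real_of_int (ip p (\<pi> ! k)) - speed * real k\<bar> \<le> ?D"
    using axis_close[OF \<pi> u(1) assms(3) \<epsilon> ty[OF u(1)]] by blast
  obtain q where q: "q \<in> {(0, 1), - (0, 1)}"
    "\<And>k. k \<le> L \<Longrightarrow> \<bar>real_of_int (ip q (\<pi> ! k)) - speed * real k\<bar> \<le> ?D"
    using axis_close[OF \<pi> u(2) assms(3) \<epsilon> ty[OF u(2)]] by blast
  define a where "a = real_of_int (fst p)"
  define b where "b = real_of_int (snd q)"
  have ab: "a \<in> {1, -1}" "b \<in> {1, -1}" using p(1) q(1) by (auto simp: a_def b_def)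
  have x: "\<bar>real_of_int (fst (\<pi> ! k)) - speed * a * real k\<bar> \<le> ?D" if "k \<le> L" for k
    using p(1) p(2)[OF that] by (auto simp: a_def ip_def abs_le_iff)
  have y: "\<bar>real_of_int (snd (\<pi> ! k)) - speed * b * real k\<bar> \<le> ?D" if "k \<le> L" for k
    using q(1) q(2)[OF that] by (auto simp: b_def ip_def abs_le_iff)
  obtain i where i: "i \<in> {1, 2, 3, 4::nat}" "diag_dir i = (a, b)"
  proof -
    have "diag_dir 1 = (1, 1)" "diag_dir 2 = (-1, 1)" "diag_dir 3 = (-1, -1)" "diag_dir 4 = (1, -1)"
      by (auto simp: diag_dir_def)
    then show ?thesis using that ab by auto
  qed
  have "2 * ?D / real L \<le> \<epsilon>'" using D assms(2) by (simp add: divide_le_eq)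
  then have "norm (rescaled_path L \<pi> t - (speed * t) *\<^sub>R diag_dir i) \<le> \<epsilon>'" if "t \<in> {0..1}" for t
    unfolding i(2) using rescaled_path_close[OF assms(2) x y that] by linarith
  then have "(SUP t\<in>{0..1}. norm (rescaled_path L \<pi> t - (speed * t) *\<^sub>R diag_dir i)) \<le> \<epsilon>'"
    by (intro cSUP_least) auto
  then show ?thesis using i(1) unfolding tracks_diagonal_def by blast
qed

text \<open>A rare event for the prefix of a length comparable to \<open>L\<close> is unlikely for the whole walk,
  since a prefix of length \<open>k\<close> has at most as many continuations as there are walks of length \<open>L - k\<close>.\<close>

lemma rare_prefix_negligible:
  assumes A: "rare A" and sub: "\<And>k. A k \<subseteq> prudent_paths k" and "0 < a"
  shows "(\<lambda>L. real (card {\<pi> \<in> prudent_paths L. \<exists>k\<le>L. a * real L \<le> real k \<and> take (Suc k) \<pi> \<in> A k}) /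
     real (card (prudent_paths L))) \<longlonglongrightarrow> 0"
proof -
  obtain C \<delta> where C: "C > 0" "\<delta> > 0" "\<And>L. real (card (A L)) \<le> C / \<sigma> ^ L * exp (- (\<delta> * real L))"
    using A unfolding rare_def by blast
  \<comment> \<open>The prefix gains at least \<open>3 * \<eta> * L\<close> in the exponent. The
    count of continuations and the lower bound on all walks lose \<eta> each, and the remaining
    \<eta> beats the number of choices of \<open>k\<close>.\<close>
  define \<eta> where "\<eta> = \<delta> * a / 3"
  have \<eta>: "0 < \<eta>" using C assms(3) by (simp add: \<eta>_def)
  obtain C1 where C1: "0 < C1" "\<And>L. real (card (prudent_paths L)) \<le> C1 / \<sigma> ^ L * exp (\<eta> * real L)"
    using card_upper_bound[OF \<eta>] by blast
  obtain C2 L0 where C2: "0 < C2" "\<And>L. L \<ge> L0 \<Longrightarrow> C2 / \<sigma> ^ L * exp (- (\<eta> * real L)) \<le> real (card (prudent_paths L))"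
    using card_lower_bound'[OF \<eta>] by blast
  let ?S = "\<lambda>L. {\<pi> \<in> prudent_paths L. \<exists>k\<le>L. a * real L \<le> real k \<and> take (Suc k) \<pi> \<in> A k}"
  have S: "real (card (?S L)) \<le> real (Suc L) * (C * C1 / \<sigma> ^ L * exp (- (2 * \<eta> * real L)))" for L
  proof -
    let ?T = "\<lambda>k. {\<pi> \<in> prudent_paths L. take (Suc k) \<pi> \<in> A k}"
    let ?K = "{k. k \<le> L \<and> a * real L \<le> real k}"
    have fin: "finite ?K" by (rule finite_subset[of _ "{..L}"]) auto
    have "card (?S L) \<le> card (\<Union>k\<in>?K. ?T k)"
      using fin by (intro card_mono) (auto simp: finite_prudent_paths)
    also have "\<dots> \<le> (\<Sum>k\<in>?K. card (?T k))" using fin by (rule card_UN_le)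
    finally have "real (card (?S L)) \<le> real (\<Sum>k\<in>?K. card (?T k))" by (rule of_nat_mono)
    also have "\<dots> = (\<Sum>k\<in>?K. real (card (?T k)))" by (rule of_nat_sum)
    also have "\<dots> \<le> (\<Sum>k\<in>?K. C * C1 / \<sigma> ^ L * exp (- (2 * \<eta> * real L)))"
    proof (rule sum_mono)
      fix k assume k: "k \<in> ?K"
      have "card (?T k) \<le> card (A k) * card (prudent_paths (L - k))"
        using k by (intro card_prefix_in sub) simp
      then have "real (card (?T k)) \<le> real (card (A k)) * real (card (prudent_paths (L - k)))"
        by (simp only: of_nat_le_iff flip: of_nat_mult)
      also have "\<dots> \<le> (C / \<sigma> ^ k * exp (- (\<delta> * real k))) * (C1 / \<sigma> ^ (L - k) * exp (\<eta> * real (L - k)))"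
        using C C1 \<sigma>_pos by (intro mult_mono) auto
      also have "\<dots> = C * C1 / (\<sigma> ^ k * \<sigma> ^ (L - k)) * (exp (- (\<delta> * real k)) * exp (\<eta> * real (L - k)))"
        by simp
      also have "\<sigma> ^ k * \<sigma> ^ (L - k) = \<sigma> ^ L" using k by (simp flip: power_add)
      also have "exp (- (\<delta> * real k)) * exp (\<eta> * real (L - k)) = exp (- (\<delta> * real k) + \<eta> * real (L - k))"
        by (rule exp_add[symmetric])
      also have "C * C1 / \<sigma> ^ L * \<dots> \<le> C * C1 / \<sigma> ^ L * exp (- (2 * \<eta> * real L))"
      proof (rule mult_left_mono)
        have "\<delta> * (a * real L) \<le> \<delta> * real k" using k C by (intro mult_left_mono) auto
        moreover have "\<delta> * (a * real L) = 3 * (\<eta> * real L)" by (simp add: \<eta>_def)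
        moreover have "\<eta> * real (L - k) \<le> \<eta> * real L" using \<eta> by (intro mult_left_mono) auto
        ultimately have "- (\<delta> * real k) + \<eta> * real (L - k) \<le> - (2 * \<eta> * real L)" by linarith
        then show "exp (- (\<delta> * real k) + \<eta> * real (L - k)) \<le> exp (- (2 * \<eta> * real L))" by simp
      qed (use C C1 \<sigma>_pos in auto)
      finally show "real (card (?T k)) \<le> C * C1 / \<sigma> ^ L * exp (- (2 * \<eta> * real L))" .
    qed
    also have "\<dots> = real (card ?K) * (C * C1 / \<sigma> ^ L * exp (- (2 * \<eta> * real L)))" by simp
    also have "\<dots> \<le> real (Suc L) * (C * C1 / \<sigma> ^ L * exp (- (2 * \<eta> * real L)))"
    proof (rule mult_right_mono)
      have "card ?K \<le> card {..L}" by (intro card_mono) auto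
      then show "real (card ?K) \<le> real (Suc L)" by simp
    qed (use C C1 \<sigma>_pos in auto)
    finally show ?thesis .
  qed
  have bound: "\<forall>\<^sub>F L in sequentially. real (card (?S L)) / real (card (prudent_paths L)) \<le>
      C * C1 / C2 * (real (Suc L) * exp (- (\<eta> * real L)))"
    using eventually_ge_at_top[of L0]
  proof eventually_elim
    case (elim L)
    have low: "0 < C2 / \<sigma> ^ L * exp (- (\<eta> * real L))" using C2 \<sigma>_pos by simp
    have "real (card (?S L)) / real (card (prudent_paths L)) \<le>
        (real (Suc L) * (C * C1 / \<sigma> ^ L * exp (- (2 * \<eta> * real L)))) / (C2 / \<sigma> ^ L * exp (- (\<eta> * real L)))"
      using C C1 \<sigma>_pos by (intro frac_le S C2(2)[OF elim] low) (auto intro!: mult_nonneg_nonneg)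
    also have "exp (- (2 * \<eta> * real L)) = exp (- (\<eta> * real L)) * exp (- (\<eta> * real L))"
      by (simp flip: exp_add)
    also have "(real (Suc L) * (C * C1 / \<sigma> ^ L * (exp (- (\<eta> * real L)) * exp (- (\<eta> * real L))))) / (C2 / \<sigma> ^ L * exp (- (\<eta> * real L)))
       = C * C1 / C2 * (real (Suc L) * exp (- (\<eta> * real L)))"
      using C2(1) \<sigma>_pos by simp
    finally show ?case .
  qed
  have "(\<lambda>L. C * C1 / C2 * (real (Suc L) * exp (- (\<eta> * real L)))) \<longlonglongrightarrow> C * C1 / C2 * 0"
    using \<eta> by (intro tendsto_mult tendsto_const) real_asymp
  then show ?thesis
    by (intro tendsto_sandwich[OF _ bound tendsto_const]) auto
qed

theorem theorem2p2:
  "\<exists>c::real. c > 0 \<and> (\<forall>\<epsilon>::real. \<epsilon> > 0 \<longrightarrow>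
     (\<lambda>L. measure_pmf.prob (P_unif L)
            {\<pi>. \<exists>i\<in>{1, 2, 3, 4}.
               (SUP t\<in>{0..1}. norm (rescaled_path L \<pi> t - (c * t) *\<^sub>R diag_dir i)) \<le> \<epsilon>})
     \<longlonglongrightarrow> 1)"
proof (intro exI[of _ speed] conjI allI impI speed_pos)
  fix \<epsilon> :: real assume \<epsilon>: "0 < \<epsilon>"
  \<comment> \<open>Of the allowed error \<open>\<epsilon> * L\<close>, the atypicality \<delta> and
    the initial stretch up to \<open>k0\<close> each use at most a quarter. The fifth of
    \<open>speed\<close> gives \<open>4 * \<delta> < speed\<close>. Rounding \<open>a * L\<close> up
    to \<open>k0\<close> at most doubles it, so \<open>a \<le> 1 / 2\<close> keeps \<open>k0\<close>
    within \<open>L\<close>.\<close>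
  define \<delta> where "\<delta> = min (\<epsilon> / 16) (speed / 5)"
  define a where "a = min (1 / 2) (\<epsilon> / (16 * (1 + speed)))"
  have \<delta>: "0 < \<delta>" "\<delta> \<le> \<epsilon> / 16" "4 * \<delta> < speed" using \<epsilon> speed_pos by (auto simp: \<delta>_def min_def)
  have a: "0 < a" "a \<le> 1 / 2" "(1 + speed) * a \<le> \<epsilon> / 16"
  proof -
    show "0 < a" using \<epsilon> speed_pos by (simp add: a_def)
    show "a \<le> 1 / 2" unfolding a_def by (rule min.cobounded1)
    have "a \<le> \<epsilon> / (16 * (1 + speed))" by (simp add: a_def)
    then show "(1 + speed) * a \<le> \<epsilon> / 16" using speed_pos by (simp add: le_divide_eq mult_ac)
  qed
  define A where "A = (\<lambda>k. {\<pi> \<in> prudent_paths k. \<exists>e\<in>unit_steps. \<not> typical \<delta> e k \<pi>})"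
  have A: "rare A"
  proof -
    have r: "rare (\<lambda>L. {\<pi> \<in> prudent_paths L. \<not> typical \<delta> e L \<pi>})" if "e \<in> unit_steps" for e
      using \<delta>(1) that by (rule rare_atypical)
    have u: "(1, 0) \<in> unit_steps" "(-1, 0) \<in> unit_steps" "(0, 1) \<in> unit_steps" "(0, -1) \<in> unit_steps"
      by (auto simp: unit_steps_def)
    show ?thesis
      by (rule rare_subset[OF rare_Un[OF rare_Un[OF r[OF u(1)] r[OF u(2)]] rare_Un[OF r[OF u(3)] r[OF u(4)]]]])
        (auto simp: A_def unit_steps_def finite_prudent_paths)
  qed
  let ?S = "\<lambda>L. {\<pi> \<in> prudent_paths L. \<exists>k\<le>L. a * real L \<le> real k \<and> take (Suc k) \<pi> \<in> A k}"
  have lim: "(\<lambda>L. 1 - real (card (?S L)) / real (card (prudent_paths L))) \<longlonglongrightarrow> 1 - 0"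
    by (intro tendsto_diff tendsto_const rare_prefix_negligible A a(1)) (auto simp: A_def)
  have good: "\<forall>\<^sub>F L in sequentially. prudent_paths L - ?S L \<subseteq> tracks_diagonal \<epsilon> L"
  proof -
    have "\<forall>\<^sub>F L in sequentially. real L \<ge> 1 / (\<delta> * a) + 1 / a + 1"
      by (rule filterlim_real_sequentially[THEN filterlim_at_top[THEN iffD1], rule_format])
    then show ?thesis
    proof eventually_elim
      case (elim L)
      have pos: "0 < 1 / (\<delta> * a)" "0 < 1 / a" using \<delta> a by auto
      then have "0 < real L" and L: "1 / (\<delta> * a) \<le> real L" "1 / a \<le> real L" using elim by linarith+
      then have L0: "0 < L" by simp
      have aL: "1 \<le> a * real L" "1 \<le> \<delta> * (a * real L)"
        using L \<delta> a by (auto simp: divide_le_eq mult_ac)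
      define k0 where "k0 = nat \<lceil>a * real L\<rceil>"
      have k0: "a * real L \<le> real k0" "real k0 \<le> 2 * (a * real L)" unfolding k0_def using aL by linarith+
      have "2 * (a * real L) \<le> real L" using a(2) mult_right_mono[of a "1 / 2" "real L"] by simp
      then have k0L: "k0 \<le> L" using k0 by linarith
      show ?case
      proof
        fix \<pi> assume \<pi>: "\<pi> \<in> prudent_paths L - ?S L"
        show "\<pi> \<in> tracks_diagonal \<epsilon> L"
        proof (rule typical_imp_tracks[OF _ L0 k0L \<delta>(1,3)])
          show "\<pi> \<in> prudent_paths L" using \<pi> by simp
          have "\<delta> * (a * real L) \<le> \<delta> * real k0" using k0 \<delta> by (intro mult_left_mono) auto
          then show "1 \<le> \<delta> * real k0" using aL by linarith
          show "typical \<delta> e k (take (Suc k) \<pi>)" if "e \<in> unit_steps" "k0 \<le> k" "k \<le> L" for e k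
          proof -
            have "a * real L \<le> real k" using k0(1) that(2) by linarith
            then have "take (Suc k) \<pi> \<notin> A k" using \<pi> that by auto
            then show ?thesis using prudent_paths_take[of \<pi> L k] \<pi> that by (auto simp: A_def)
          qed
          have "(1 + speed) * real k0 \<le> (1 + speed) * (2 * (a * real L))"
            using k0 speed_pos by (intro mult_left_mono) auto
          also have "\<dots> = 2 * ((1 + speed) * a * real L)" by simp
          also have "\<dots> \<le> 2 * (\<epsilon> / 16 * real L)" using a(3) by (intro mult_left_mono mult_right_mono) auto
          finally have "(1 + speed) * real k0 \<le> \<epsilon> * real L / 8" by simp
          moreover have "\<delta> * real L \<le> \<epsilon> / 16 * real L" using \<delta>(2) by (intro mult_right_mono) auto
          moreover have "0 \<le> \<epsilon> * real L" using \<epsilon> by simp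
          ultimately show "2 * (2 * \<delta> * real L + (1 + speed) * real k0) \<le> \<epsilon> * real L" by simp
        qed
      qed
    qed
  qed
  have "\<forall>\<^sub>F L in sequentially. 1 - real (card (?S L)) / real (card (prudent_paths L))
      \<le> measure_pmf.prob (P_unif L) (tracks_diagonal \<epsilon> L)"
    using good
  proof eventually_elim
    case (elim L)
    have N: "0 < card (prudent_paths L)"
      using finite_prudent_paths prudent_paths_nonempty by (simp add: card_gt_0_iff)
    have "card (prudent_paths L) - card (?S L) = card (prudent_paths L - ?S L)"
      by (subst card_Diff_subset) (auto intro: finite_subset[OF _ finite_prudent_paths])
    also have "\<dots> \<le> card (prudent_paths L \<inter> tracks_diagonal \<epsilon> L)"
      using elim by (intro card_mono) (auto simp: finite_prudent_paths)
    finally have "real (card (prudent_paths L)) - real (card (?S L)) \<le> real (card (prudent_paths L \<inter> tracks_diagonal \<epsilon> L))"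
      by linarith
    then have "(real (card (prudent_paths L)) - real (card (?S L))) / real (card (prudent_paths L))
        \<le> real (card (prudent_paths L \<inter> tracks_diagonal \<epsilon> L)) / real (card (prudent_paths L))"
      by (intro divide_right_mono) auto
    then show ?case
      using N by (simp add: P_unif_def measure_pmf_of_set finite_prudent_paths prudent_paths_nonempty diff_divide_distrib)
  qed
  moreover have "\<forall>\<^sub>F L in sequentially. measure_pmf.prob (P_unif L) (tracks_diagonal \<epsilon> L) \<le> 1"
    by (rule always_eventually) (rule allI, rule measure_pmf.prob_le_1)
  ultimately have "(\<lambda>L. measure_pmf.prob (P_unif L) (tracks_diagonal \<epsilon> L)) \<longlonglongrightarrow> 1"
    using lim unfolding diff_zero by (rule tendsto_sandwich) (rule tendsto_const)
  then show "(\<lambda>L. measure_pmf.prob (P_unif L)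
            {\<pi>. \<exists>i\<in>{1, 2, 3, 4}.
               (SUP t\<in>{0..1}. norm (rescaled_path L \<pi> t - (speed * t) *\<^sub>R diag_dir i)) \<le> \<epsilon>}) \<longlonglongrightarrow> 1"
    unfolding tracks_diagonal_def .
qed

end
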